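(* Let $A$ be a Hermitian Banach $*$-algebra and let $D$ be a closed $*$-subalgebra of $A$ (a normed $*$-algebra with the inherited norm). Then every state on $D$ extends to a state on $A$.
   Context: All algebras are complex. A Banach $*$-algebra is a complete complex algebra with an involution $a\mapsto a^*$ (conjugate linear, $(ab)^*=b^*a^*$, $a^{**}=a$) and a norm with $|ab|\le|a||b|$; the involution need not be continuous. $A$ is Hermitian if every Hermitian element ($a=a^*$) has real spectrum. For a normed $*$-algebra $B$, let $B_{sa}=\{b:b=b^*\}$. A linear functional $\varphi$ on $B$ is positive if $\varphi(b^*b)\ge0$ for all $b$; it is weakly continuous on $B_{sa}$ if for each $c\in B$ the functional $b\mapsto\varphi(c^*bc)$ is norm-continuous on $B_{sa}$; it has finite variation if there is $\gamma\ge0$ with $|\varphi(b)|^2\le\gamma\varphi(b^*b)$ for all $b$, the least such $\gamma$ being the variation $v(\varphi)$. A state on $B$ is a positive linear functional, weakly continuous on $B_{sa}$, with $v(\varphi)=1$. *)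

theory Defs
  imports "HOL-Analysis.Analysis"
begin

text \<open>A complex Banach *-algebra is modelled on a type 'a of class
  real_normed_algebra and banach (real Banach algebra, submultiplicative norm,
  no unit required), together with a complex scalar multiplication cs extending
  the real one, and an involution st (not assumed continuous).\<close>

definition banach_star_alg :: "(complex \<Rightarrow> 'a::{real_normed_algebra,banach} \<Rightarrow> 'a) \<Rightarrow> ('a \<Rightarrow> 'a) \<Rightarrow> bool" where
  "banach_star_alg cs st \<longleftrightarrow>
     (\<forall>r x. cs (complex_of_real r) x = r *\<^sub>R x) \<and>
     (\<forall>a b x. cs (a + b) x = cs a x + cs b x) \<and>
     (\<forall>a x y. cs a (x + y) = cs a x + cs a y) \<and>
     (\<forall>a b x. cs (a * b) x = cs a (cs b x)) \<and>
     (\<forall>a x y. cs a (x * y) = cs a x * y \<and> cs a (x * y) = x * cs a y) \<and>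
     (\<forall>a x. norm (cs a x) = cmod a * norm x) \<and>
     (\<forall>x y. st (x + y) = st x + st y) \<and>
     (\<forall>a x. st (cs a x) = cs (cnj a) (st x)) \<and>
     (\<forall>x y. st (x * y) = st y * st x) \<and>
     (\<forall>x. st (st x) = x)"

text \<open>Quasi-invertibility and the spectrum of an element of a possibly
  non-unital algebra (spectrum taken relative to the unitization, Palmer's
  convention: 0 always belongs to it; nonzero lambda is in the spectrum iff
  a/lambda is not quasi-invertible).\<close>

definition quasi_invertible :: "'a::real_normed_algebra \<Rightarrow> bool" where
  "quasi_invertible a \<longleftrightarrow> (\<exists>b. a + b - a * b = 0 \<and> a + b - b * a = 0)"

definition alg_spectrum :: "(complex \<Rightarrow> 'a::real_normed_algebra \<Rightarrow> 'a) \<Rightarrow> 'a \<Rightarrow> complex set" where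
  "alg_spectrum cs a = {0} \<union> {z. z \<noteq> 0 \<and> \<not> quasi_invertible (cs (inverse z) a)}"

definition hermitian_alg :: "(complex \<Rightarrow> 'a::real_normed_algebra \<Rightarrow> 'a) \<Rightarrow> ('a \<Rightarrow> 'a) \<Rightarrow> bool" where
  "hermitian_alg cs st \<longleftrightarrow> (\<forall>a. st a = a \<longrightarrow> alg_spectrum cs a \<subseteq> \<real>)"

definition star_subalg :: "(complex \<Rightarrow> 'a::real_normed_algebra \<Rightarrow> 'a) \<Rightarrow> ('a \<Rightarrow> 'a) \<Rightarrow> 'a set \<Rightarrow> bool" where
  "star_subalg cs st D \<longleftrightarrow> 0 \<in> D \<and>
     (\<forall>x\<in>D. \<forall>y\<in>D. x + y \<in> D \<and> x * y \<in> D) \<and>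
     (\<forall>c. \<forall>x\<in>D. cs c x \<in> D) \<and> (\<forall>x\<in>D. st x \<in> D)"

definition lin_fun_on :: "(complex \<Rightarrow> 'a::real_normed_algebra \<Rightarrow> 'a) \<Rightarrow> 'a set \<Rightarrow> ('a \<Rightarrow> complex) \<Rightarrow> bool" where
  "lin_fun_on cs B \<phi> \<longleftrightarrow> (\<forall>x\<in>B. \<forall>y\<in>B. \<phi> (x + y) = \<phi> x + \<phi> y) \<and>
     (\<forall>c. \<forall>x\<in>B. \<phi> (cs c x) = c * \<phi> x)"

definition positive_on :: "('a::real_normed_algebra \<Rightarrow> 'a) \<Rightarrow> 'a set \<Rightarrow> ('a \<Rightarrow> complex) \<Rightarrow> bool" where
  "positive_on st B \<phi> \<longleftrightarrow> (\<forall>b\<in>B. Im (\<phi> (st b * b)) = 0 \<and> Re (\<phi> (st b * b)) \<ge> 0)"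

definition weakly_cont_sa :: "('a::real_normed_algebra \<Rightarrow> 'a) \<Rightarrow> 'a set \<Rightarrow> ('a \<Rightarrow> complex) \<Rightarrow> bool" where
  "weakly_cont_sa st B \<phi> \<longleftrightarrow>
     (\<forall>c\<in>B. continuous_on {b\<in>B. st b = b} (\<lambda>b. \<phi> (st c * b * c)))"

definition var_bound :: "('a::real_normed_algebra \<Rightarrow> 'a) \<Rightarrow> 'a set \<Rightarrow> ('a \<Rightarrow> complex) \<Rightarrow> real \<Rightarrow> bool" where
  "var_bound st B \<phi> \<gamma> \<longleftrightarrow> \<gamma> \<ge> 0 \<and> (\<forall>b\<in>B. (cmod (\<phi> b))\<^sup>2 \<le> \<gamma> * Re (\<phi> (st b * b)))"

definition finite_variation :: "('a::real_normed_algebra \<Rightarrow> 'a) \<Rightarrow> 'a set \<Rightarrow> ('a \<Rightarrow> complex) \<Rightarrow> bool" where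
  "finite_variation st B \<phi> \<longleftrightarrow> (\<exists>\<gamma>. var_bound st B \<phi> \<gamma>)"

definition variation :: "('a::real_normed_algebra \<Rightarrow> 'a) \<Rightarrow> 'a set \<Rightarrow> ('a \<Rightarrow> complex) \<Rightarrow> real" where
  "variation st B \<phi> = Inf {\<gamma>. var_bound st B \<phi> \<gamma>}"

definition state_on :: "(complex \<Rightarrow> 'a::real_normed_algebra \<Rightarrow> 'a) \<Rightarrow> ('a \<Rightarrow> 'a) \<Rightarrow> 'a set \<Rightarrow> ('a \<Rightarrow> complex) \<Rightarrow> bool" where
  "state_on cs st B \<phi> \<longleftrightarrow> lin_fun_on cs B \<phi> \<and> positive_on st B \<phi> \<and>
     weakly_cont_sa st B \<phi> \<and> finite_variation st B \<phi> \<and> variation st B \<phi> = 1"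

end

theory Submission
  imports Defs
begin

text \<open>
  Work in the real unitization \<open>A \<oplus> \<real>\<close>: scalars from \<open>\<real>\<close> suffice, and unlike \<open>A \<oplus> \<complex>\<close>
  it is an instance of the type classes of unital Banach algebras. The Hermitian property enters only
  through the invertibility of \<open>1 + h h\<close> for hermitian and of \<open>1 + k\<close> for skew elements.

  From these two facts one gets Ford's square root lemma (for a possibly discontinuous involution),
  Ptak's invertibility of \<open>1 - p q\<close> for hermitian \<open>p\<close>, \<open>q\<close> of spectral radius less than 1, hence the
  convexity of the cone of hermitian elements with nonnegative spectrum, and the Shirali--Ford
  theorem that this cone contains all \<open>a\<^sup>* a\<close>.

  Weak continuity makes the state real and norm-bounded on hermitian elements, and then
  \<open>\<phi>(x)\<^bsup>2^n\<^esup> \<le> \<phi>(x\<^bsup>2^n\<^esup>)\<close> bounds it by the spectral radius, so it is nonnegative on the part of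
  the cone lying over \<open>D\<close>. A Hahn--Banach (M. Riesz) extension that is nonnegative on the cone
  is the required state.
\<close>

section \<open>Invertible elements and the spectral radius\<close>

text \<open>The real unitization has no complex spectrum, so conjugate pairs of spectral points are
  treated together through real quadratic polynomials; for hermitian \<open>h\<close> these are sums
  of two squares, which is where \<open>1 + h h\<close> enters. A discontinuous involution hurts at
  the square root: the adjoint of a series may not be taken termwise, so being hermitian has to come
  from algebra and a spectral estimate. A second obstacle lies in \<open>D\<close>: without a unit,
  weak continuity controls \<open>\<phi> (st c * b * c)\<close> but not \<open>\<phi> b\<close>.
  Variation 1 repairs this. It supplies \<open>b\<close> in \<open>D\<close> imitating the unit in
  the seminorm of \<open>\<phi>\<close>, and \<open>\<phi> d\<close> is a limit of real numbers
  \<open>\<phi> (st b * d * b)\<close>, whose bound by \<open>norm d\<close> involves no constant of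
  continuity. Positivity over \<open>D\<close> is tested with the cone of the unitization of
  \<open>A\<close>, so spectra relative to \<open>D\<close> never occur. The extension is built with
  real values and zero on skew elements; multiplication by \<open>\<i>\<close> recovers its
  imaginary part. Its norm bound on hermitian elements gives weak continuity, since
  \<open>st c * b * c\<close> is hermitian with \<open>b\<close>.\<close>

definition inv_el :: "'a::real_normed_algebra_1 \<Rightarrow> bool" where
  "inv_el x \<longleftrightarrow> (\<exists>y. x * y = 1 \<and> y * x = 1)"

definition iv :: "'a::real_normed_algebra_1 \<Rightarrow> 'a" where
  "iv x = (SOME y. x * y = 1 \<and> y * x = 1)"

lemma iv: assumes "inv_el x" shows "x * iv x = 1" "iv x * x = 1"
  using someI_ex[OF assms[unfolded inv_el_def]] unfolding iv_def by auto

lemma iv_cancel: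
  assumes "inv_el x" shows "x * (iv x * z) = z" "iv x * (x * z) = z"
  using iv[OF assms] by (metis mult.assoc mult_1_left)+

lemma inv_elI: "x * y = 1 \<Longrightarrow> z * x = 1 \<Longrightarrow> inv_el x"
  unfolding inv_el_def by (metis mult.assoc mult_1_left mult_1_right)

lemma iv_unique: "x * y = 1 \<Longrightarrow> y * x = 1 \<Longrightarrow> iv x = y"
  by (metis inv_elI iv_cancel(2) mult_1_right)

lemma inv_el_1: "inv_el 1"
  unfolding inv_el_def by force

lemma inv_el_mult: assumes "inv_el x" "inv_el y" shows "inv_el (x * y)"
  by (rule inv_elI[of _ "iv y * iv x" "iv y * iv x"])
     (simp_all add: mult.assoc iv_cancel assms iv)

lemma inv_el_iv: "inv_el x \<Longrightarrow> inv_el (iv x)"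
  using iv unfolding inv_el_def by blast

lemma inv_el_scaleR: assumes "inv_el x" "c \<noteq> 0" shows "inv_el (c *\<^sub>R x)"
  by (rule inv_elI[of _ "inverse c *\<^sub>R iv x" "inverse c *\<^sub>R iv x"]) (simp_all add: assms iv)

lemma inv_el_scaleR_iff: "c \<noteq> 0 \<Longrightarrow> inv_el (c *\<^sub>R x) \<longleftrightarrow> inv_el x"
  using inv_el_scaleR[of x c] inv_el_scaleR[of "c *\<^sub>R x" "inverse c"] by auto

lemma inv_el_factors:
  assumes "inv_el (x * y)" "inv_el (y' * x)" shows "inv_el x"
proof (rule inv_elI)
  show "x * (y * iv (x * y)) = 1" using iv(1)[OF assms(1)] by (simp add: mult.assoc)
  show "iv (y' * x) * y' * x = 1" using iv(2)[OF assms(2)] by (simp add: mult.assoc)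
qed
    
lemma inv_el_factor1: "inv_el (x * y) \<Longrightarrow> x * y = y * x \<Longrightarrow> inv_el x"
  by (metis inv_el_factors)

lemma iv_commute: assumes "inv_el x" "x * z = z * x" shows "iv x * z = z * iv x"
  by (metis assms iv iv_cancel mult.assoc mult_1_right)

text \<open>The inverse is \<open>1 - b (1 + a b)^-1 a\<close>. This exchanges
  \<open>x * st x\<close> and \<open>st x * x\<close>, and moves factors cyclically.\<close>

lemma inv_el_one_plus_swap:
  assumes "inv_el (1 + a * b)" shows "inv_el (1 + b * a)"
proof -
  let ?w = "iv (1 + a * b)"
  have 1: "?w + a * (b * ?w) = 1" "?w + ?w * (a * b) = 1"
    using iv[OF assms] by (simp_all add: algebra_simps)
  have 2: "a * (b * ?w) = 1 - ?w" "?w * (a * b) = 1 - ?w"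
    using 1 by (simp_all add: algebra_simps)
  have "(1 + b * a) * (1 - b * ?w * a) = 1 + b * a - b * (?w + a * (b * ?w)) * a"
    by (simp add: algebra_simps)
  moreover have "(1 - b * ?w * a) * (1 + b * a) = 1 + b * a - b * (?w + ?w * (a * b)) * a"
    by (simp add: algebra_simps)
  ultimately show ?thesis
    by (intro inv_elI[of _ "1 - b * ?w * a" "1 - b * ?w * a"]) (simp_all add: 1)
qed

section \<open>Neumann series and continuity of inversion\<close>

lemma inv_el_one_minus_summable:
  fixes x :: "'a::{real_normed_algebra_1,banach}"
  assumes "summable (\<lambda>n. norm (x ^ n))" shows "inv_el (1 - x)"
proof -
  have s: "summable (\<lambda>n. x ^ n)" by (rule summable_norm_cancel[OF assms])
  have t: "(\<Sum>n. x ^ n) = 1 + (\<Sum>n. x ^ Suc n)"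
    using suminf_split_head[OF s] by simp
  have "x * (\<Sum>n. x ^ n) = (\<Sum>n. x ^ Suc n)" by (simp add: suminf_mult[OF s])
  moreover have "(\<Sum>n. x ^ n) * x = (\<Sum>n. x ^ Suc n)"
    by (simp add: suminf_mult2[OF s] power_commutes)
  ultimately have "(1 - x) * (\<Sum>n. x ^ n) = 1" "(\<Sum>n. x ^ n) * (1 - x) = 1"
    using t by (simp_all add: algebra_simps)
  then show ?thesis by (rule inv_elI)
qed

lemma inv_el_one_minus:
  fixes x :: "'a::{real_normed_algebra_1,banach}"
  assumes "norm x < 1" shows "inv_el (1 - x)"
proof (rule inv_el_one_minus_summable)
  show "summable (\<lambda>n. norm (x ^ n))"
    by (rule summable_comparison_test'[of "\<lambda>n. norm x ^ n" 0])
       (use assms in \<open>auto intro: summable_geometric norm_power_ineq\<close>)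
qed

text \<open>Resolvent identity; the factor 1/2 in the hypothesis lets the unknown norm of
  \<open>iv b\<close> be absorbed, giving \<open>norm (iv b) \<le> 2 * norm (iv a)\<close>.\<close>

lemma norm_iv_diff:
  assumes "inv_el a" "inv_el b" "norm (b - a) * norm (iv a) \<le> 1 / 2"
  shows "norm (iv b - iv a) \<le> 2 * (norm (iv a))\<^sup>2 * norm (b - a)"
proof -
  have e: "iv b - iv a = iv b * (a - b) * iv a"
    by (simp add: algebra_simps iv_cancel iv assms)
  have "norm (iv b) \<le> norm (iv a) + norm (iv b - iv a)"
    by (metis add.commute diff_add_cancel norm_triangle_ineq)
  also have "norm (iv b - iv a) \<le> norm (iv b) * norm (a - b) * norm (iv a)"
    unfolding e by (meson norm_mult_ineq norm_ge_zero mult_right_mono order_trans)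
  finally have "norm (iv b) \<le> norm (iv a) + norm (iv b) * (norm (b - a) * norm (iv a))"
    by (simp add: norm_minus_commute mult.assoc)
  also have "\<dots> \<le> norm (iv a) + norm (iv b) * (1 / 2)"
    by (intro add_left_mono mult_left_mono assms) auto
  finally have n: "norm (iv b) \<le> 2 * norm (iv a)" by simp
  have "norm (iv b - iv a) \<le> norm (iv b) * norm (a - b) * norm (iv a)"
    unfolding e by (meson norm_mult_ineq norm_ge_zero mult_right_mono order_trans)
  also have "\<dots> \<le> (2 * norm (iv a)) * norm (a - b) * norm (iv a)"
    by (intro mult_right_mono n) auto
  finally show ?thesis by (simp add: power2_eq_square norm_minus_commute mult_ac)
qed

lemma continuous_on_iv:
  assumes "continuous_on S f" "\<And>s. s \<in> S \<Longrightarrow> inv_el (f s)"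
  shows "continuous_on S (\<lambda>s. iv (f s))"
  unfolding continuous_on_def
proof
  fix s assume s: "s \<in> S"
  have f: "(f \<longlongrightarrow> f s) (at s within S)"
    using assms(1) s by (auto simp: continuous_on_def)
  then have d: "((\<lambda>t. norm (f t - f s)) \<longlongrightarrow> 0) (at s within S)"
    by (metis LIM_zero tendsto_norm_zero)
  have "((\<lambda>t. norm (f t - f s) * norm (iv (f s))) \<longlongrightarrow> 0 * norm (iv (f s))) (at s within S)"
    by (intro tendsto_intros d)
  then have "\<forall>\<^sub>F t in at s within S. norm (f t - f s) * norm (iv (f s)) < 1 / 2"
    by (intro order_tendstoD(2)) auto
  moreover have "\<forall>\<^sub>F t in at s within S. t \<in> S"
    by (simp add: eventually_at_filter)
  ultimately have "\<forall>\<^sub>F t in at s within S.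
      norm (iv (f t) - iv (f s)) \<le> 2 * (norm (iv (f s)))\<^sup>2 * norm (f t - f s)"
    by eventually_elim (rule norm_iv_diff, use assms(2) s in auto)
  moreover have "((\<lambda>t. 2 * (norm (iv (f s)))\<^sup>2 * norm (f t - f s)) \<longlongrightarrow> 2 * (norm (iv (f s)))\<^sup>2 * 0) (at s within S)"
    by (rule tendsto_mult[OF tendsto_const d])
  ultimately have "((\<lambda>t. iv (f t) - iv (f s)) \<longlongrightarrow> 0) (at s within S)"
    using Lim_null_comparison[of "\<lambda>t. iv (f t) - iv (f s)"] by simp
  then show "((\<lambda>t. iv (f t)) \<longlongrightarrow> iv (f s)) (at s within S)"
    by (rule LIM_zero_cancel)
qed

text \<open>Equivalent to spectral radius less than 1; powers of 2 suit repeated squaring.\<close>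

definition small :: "'a::real_normed_algebra_1 \<Rightarrow> bool" where
  "small x \<longleftrightarrow> (\<exists>n. norm (x ^ (2 ^ n)) < 1)"

lemma power_double: "(x::'a::monoid_mult) ^ (2 ^ Suc n) = (x * x) ^ (2 ^ n)"
  by (metis power2_eq_square power_mult power_Suc)

lemma small_power_bound:
  fixes x :: "'a::real_normed_algebra_1"
  assumes "small x"
  obtains M r where "0 < r" "r < 1" "0 \<le> M" "\<And>n. norm (x ^ n) \<le> M * r ^ n"
proof -
  obtain k where k: "norm (x ^ (2 ^ k)) < 1" using assms unfolding small_def by auto
  define N :: nat where "N = 2 ^ k"
  have N: "N > 0" by (simp add: N_def)
  \<comment> \<open>The floor 1/2 keeps \<open>q\<close>, hence \<open>r\<close>, positive even when
    \<open>x ^ N = 0\<close>.\<close>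
  define q where "q = max (1/2) (norm (x ^ N))"
  have q: "0 < q" "q < 1" "norm (x ^ N) \<le> q" using k by (auto simp: q_def N_def)
  define r where "r = root N q"
  have r: "0 < r" "r < 1" "r ^ N = q" using q N by (auto simp: r_def)
  define M where "M = (\<Sum>i<N. norm (x ^ i) / r ^ i)"
  have M: "0 \<le> M" using r by (auto simp: M_def intro!: sum_nonneg)
  have "norm (x ^ n) \<le> M * r ^ n" for n
  proof -
    let ?d = "n div N" and ?m = "n mod N"
    have "norm (x ^ ?m) / r ^ ?m \<le> M" unfolding M_def
      using N r by (intro member_le_sum) auto
    then have m: "norm (x ^ ?m) \<le> M * r ^ ?m" using r by (simp add: field_simps)
    have "x ^ n = (x ^ N) ^ ?d * x ^ ?m"
      by (simp add: power_mult[symmetric] power_add[symmetric])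
    then have "norm (x ^ n) \<le> norm ((x ^ N) ^ ?d) * norm (x ^ ?m)"
      by (simp add: norm_mult_ineq)
    also have "\<dots> \<le> norm (x ^ N) ^ ?d * (M * r ^ ?m)"
      by (intro mult_mono norm_power_ineq m) auto
    also have "\<dots> \<le> q ^ ?d * (M * r ^ ?m)"
      using M r q by (intro mult_right_mono power_mono) auto
    also have "q ^ ?d * r ^ ?m = r ^ n"
      by (metis r(3) power_mult power_add mult_div_mod_eq)
    then have "q ^ ?d * (M * r ^ ?m) = M * r ^ n" by (simp add: mult.left_commute)
    finally show ?thesis .
  qed
  then show thesis using that r M by blast
qed

lemma small_summable:
  fixes x :: "'a::real_normed_algebra_1"
  assumes "small x" shows "summable (\<lambda>n. norm (x ^ n))"
proof -
  obtain M r where "0 < r" "r < 1" "0 \<le> M" and b: "\<And>n. norm (x ^ n) \<le> M * r ^ n"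
    using small_power_bound[OF assms] by metis
  then have "summable (\<lambda>n. M * r ^ n)" by (intro summable_mult summable_geometric) auto
  then show ?thesis by (rule summable_comparison_test'[of _ 0]) (use b in auto)
qed

lemma small_tendsto:
  fixes x :: "'a::real_normed_algebra_1"
  assumes "small x" shows "(\<lambda>n. norm (x ^ n)) \<longlonglongrightarrow> 0"
  using small_summable[OF assms] by (rule summable_LIMSEQ_zero)

lemma small_ex:
  fixes x :: "'a::real_normed_algebra_1"
  assumes "small x" "0 < e" shows "\<exists>n0. \<forall>n\<ge>n0. norm (x ^ (2 ^ n)) < e"
proof -
  have "\<exists>n0. \<forall>n\<ge>n0. norm (x ^ n) < e"
    using order_tendstoD(2)[OF small_tendsto[OF assms(1)] assms(2)] by (auto simp: eventually_sequentially)
  then obtain n0 where n0: "\<And>n. n \<ge> n0 \<Longrightarrow> norm (x ^ n) < e" by auto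
  have "norm (x ^ (2 ^ n)) < e" if "n \<ge> n0" for n
    by (rule n0) (meson that le_trans less_exp less_imp_le)
  then show ?thesis by blast
qed

lemma small_tendstoI:
  fixes x :: "'a::real_normed_algebra_1"
  assumes "(\<lambda>n. norm (x ^ n)) \<longlonglongrightarrow> 0" shows "small x"
proof -
  obtain n0 where n0: "\<And>n. n \<ge> n0 \<Longrightarrow> norm (x ^ n) < 1"
    using order_tendstoD(2)[OF assms, of 1] by (auto simp: eventually_sequentially)
  then have "norm (x ^ (2 ^ n0)) < 1" by (simp add: less_imp_le)
  then show ?thesis unfolding small_def by blast
qed

lemma small_scaleR:
  assumes "small x" "\<bar>c\<bar> \<le> 1" shows "small (c *\<^sub>R x)"
proof -
  obtain n where "norm (x ^ (2 ^ n)) < 1" using assms(1) unfolding small_def by auto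
  moreover have "\<bar>c\<bar> ^ (2 ^ n) \<le> 1" using assms(2) by (simp add: power_le_one)
  ultimately have "\<bar>c\<bar> ^ (2 ^ n) * norm (x ^ (2 ^ n)) < 1"
    by (meson mult_le_cancel_right1 norm_not_less_zero not_less order_le_less_trans mult_left_le_one_le norm_ge_zero zero_le_power abs_ge_zero)
  then show ?thesis unfolding small_def by (auto simp: scaleR_power power_abs)
qed

lemma power_swap: "(b * a) ^ Suc n = b * (a * b) ^ n * (a::'a::monoid_mult)"
proof (induction n)
  case (Suc n)
  have "(b * a) ^ Suc (Suc n) = b * a * (b * (a * b) ^ n * a)"
    using Suc by (simp only: power_Suc[of _ "Suc n"])
  then show ?case by (simp add: mult.assoc)
qed simp

lemma small_swap:
  fixes a b :: "'a::real_normed_algebra_1"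
  assumes "small (a * b)" shows "small (b * a)"
proof (rule small_tendstoI)
  have "(\<lambda>n. norm b * norm ((a * b) ^ n) * norm a) \<longlonglongrightarrow> norm b * 0 * norm a"
    by (intro tendsto_intros small_tendsto assms)
  then have l: "(\<lambda>n. norm b * norm ((a * b) ^ n) * norm a) \<longlonglongrightarrow> 0" by simp
  have "norm (norm ((b * a) ^ Suc n)) \<le> norm b * norm ((a * b) ^ n) * norm a" for n
    unfolding power_swap real_norm_def abs_norm_cancel
    by (meson norm_mult_ineq norm_ge_zero mult_right_mono order_trans)
  then have "(\<lambda>n. norm ((b * a) ^ Suc n)) \<longlonglongrightarrow> 0"
    by (intro Lim_null_comparison[OF always_eventually l]) blast
  then show "(\<lambda>n. norm ((b * a) ^ n)) \<longlonglongrightarrow> 0"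
    by (rule LIMSEQ_imp_Suc)
qed

lemma small_inv:
  fixes x :: "'a::{real_normed_algebra_1,banach}"
  assumes "small x" shows "inv_el (1 - x)"
  by (intro inv_el_one_minus_summable small_summable assms)

text \<open>
  With \<open>u = cos \<theta>\<close> and \<open>\<omega> = exp (i \<theta>)\<close> the next two are the real forms of
  \<open>(1 - \<omega> z y) (1 - cnj \<omega> z y)\<close> and of the mean of \<open>inverse (1 - \<omega> z y)\<close> and \<open>inverse (1 - cnj \<omega> z y)\<close>.
  Averaging over \<open>\<theta>\<close> and \<open>\<theta> + \<pi>\<close> doubles the angle and squares \<open>z\<close> and \<open>y\<close>.
\<close>

definition quad :: "real \<Rightarrow> real \<Rightarrow> 'a::real_normed_algebra_1 \<Rightarrow> 'a" where
  "quad u z y = 1 - (2 * z * u) *\<^sub>R y + z\<^sup>2 *\<^sub>R (y * y)"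

definition quad_resolvent :: "real \<Rightarrow> real \<Rightarrow> 'a::real_normed_algebra_1 \<Rightarrow> 'a" where
  "quad_resolvent u z y = (1 - (z * u) *\<^sub>R y) * iv (quad u z y)"

lemma quad_double: "quad (2 * u\<^sup>2 - 1) (z\<^sup>2) (y * y) = quad u z y * quad (- u) z y"
proof -
  have *: "(1 - a *\<^sub>R y + b *\<^sub>R (y * y)) * (1 + a *\<^sub>R y + b *\<^sub>R (y * y)) =
     1 + (b *\<^sub>R (y * y) + b *\<^sub>R (y * y) - (a * a) *\<^sub>R (y * y)) + (b * b) *\<^sub>R (y * y * (y * y))" for a b
    by (simp add: algebra_simps)
  have "quad u z y * quad (- u) z y =
     1 + (z\<^sup>2 + z\<^sup>2 - (2 * z * u) * (2 * z * u)) *\<^sub>R (y * y) + (z\<^sup>2 * z\<^sup>2) *\<^sub>R (y * y * (y * y))"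
    unfolding quad_def using *[of "2 * z * u" "z\<^sup>2"]
    by (simp only: scaleR_add_left scaleR_diff_left mult_minus_right scaleR_minus_left diff_minus_eq_add)
  moreover have "z\<^sup>2 + z\<^sup>2 - (2 * z * u) * (2 * z * u) = - (2 * z\<^sup>2 * (2 * u\<^sup>2 - 1))"
    by (simp add: power2_eq_square algebra_simps)
  ultimately show ?thesis unfolding quad_def by (simp add: power2_eq_square)
qed

lemma quad_commute: "quad u z y * quad v z y = quad v z y * quad u z y"
  unfolding quad_def by (simp add: algebra_simps)

lemma quad_resolvent_double:
  assumes "inv_el (quad u z y)" "inv_el (quad (- u) z y)"
  shows "quad_resolvent u z y + quad_resolvent (- u) z y = 2 *\<^sub>R quad_resolvent (2 * u\<^sup>2 - 1) (z\<^sup>2) (y * y)"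
proof -
  let ?p = "quad u z y" and ?q = "quad (- u) z y"
  have i: "iv (?p * ?q) = iv ?q * iv ?p"
    by (rule iv_unique) (simp_all add: mult.assoc iv_cancel iv assms)
  have i': "iv (?q * ?p) = iv ?p * iv ?q"
    by (rule iv_unique) (simp_all add: mult.assoc iv_cancel iv assms)
  have c: "iv ?q * iv ?p = iv ?p * iv ?q" using i i' quad_commute by metis
  have *: "(1 - a *\<^sub>R y) * (1 + c *\<^sub>R y + b *\<^sub>R (y * y)) + (1 + a *\<^sub>R y) * (1 - c *\<^sub>R y + b *\<^sub>R (y * y)) =
     1 + 1 + (b *\<^sub>R (y * y) + b *\<^sub>R (y * y) - (a * c) *\<^sub>R (y * y) - (a * c) *\<^sub>R (y * y))" for a b c
    by (simp add: algebra_simps)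
  have "(1 - (z * u) *\<^sub>R y) * ?q + (1 + (z * u) *\<^sub>R y) * ?p
    = 2 *\<^sub>R 1 + (z\<^sup>2 + z\<^sup>2 - (z * u) * (2 * z * u) - (z * u) * (2 * z * u)) *\<^sub>R (y * y)"
    unfolding quad_def scaleR_2 using *[of "z * u" "2 * z * u" "z\<^sup>2"]
    by (simp only: scaleR_add_left scaleR_diff_left mult_minus_right scaleR_minus_left diff_minus_eq_add)
  also have "z\<^sup>2 + z\<^sup>2 - (z * u) * (2 * z * u) - (z * u) * (2 * z * u) = - (2 * (z\<^sup>2 * (2 * u\<^sup>2 - 1)))"
    by (simp add: power2_eq_square algebra_simps)
  finally have n: "(1 - (z * u) *\<^sub>R y) * ?q + (1 + (z * u) *\<^sub>R y) * ?p
    = 2 *\<^sub>R (1 - (z\<^sup>2 * (2 * u\<^sup>2 - 1)) *\<^sub>R (y * y))"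
    by (simp add: algebra_simps)
  have "quad_resolvent u z y = (1 - (z * u) *\<^sub>R y) * ?q * (iv ?q * iv ?p)"
    by (simp add: quad_resolvent_def mult.assoc iv_cancel assms)
  moreover have "quad_resolvent (- u) z y = (1 + (z * u) *\<^sub>R y) * ?p * (iv ?q * iv ?p)"
    unfolding c by (simp add: quad_resolvent_def mult.assoc iv_cancel assms)
  ultimately have "quad_resolvent u z y + quad_resolvent (- u) z y =
     ((1 - (z * u) *\<^sub>R y) * ?q + (1 + (z * u) *\<^sub>R y) * ?p) * (iv ?q * iv ?p)"
    by (simp add: distrib_right)
  then show ?thesis unfolding n quad_resolvent_def quad_double i by simp
qed

lemma half_angle:
  fixes v :: real assumes "\<bar>v\<bar> \<le> 1"
  obtains u where "\<bar>u\<bar> \<le> 1" "v = 2 * u\<^sup>2 - 1"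
proof
  show "\<bar>sqrt ((v + 1) / 2)\<bar> \<le> 1" using assms by (simp add: abs_le_iff real_sqrt_le_iff)
  show "v = 2 * (sqrt ((v + 1) / 2))\<^sup>2 - 1" using assms by (simp add: abs_le_iff field_simps)
qed

text \<open>Every \<open>u\<close> in [-1, 1] is the cosine of a doubled angle, so
  \<open>quad_double\<close> factors the polynomial of \<open>x * x\<close> at \<open>(u, z)\<close>
  into those of \<open>x\<close> at \<open>(v, sqrt z)\<close> and
  \<open>(- v, sqrt z)\<close>.\<close>

lemma quad_inv_power:
  assumes "\<And>u z. \<bar>u\<bar> \<le> 1 \<Longrightarrow> 0 \<le> z \<Longrightarrow> z \<le> 1 \<Longrightarrow> inv_el (quad u z x)"
    and "\<bar>u\<bar> \<le> 1" "0 \<le> z" "z \<le> 1"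
  shows "inv_el (quad u (z ^ (2 ^ n)) (x ^ (2 ^ n)))"
  using assms
proof (induction n arbitrary: x u z)
  case (Suc n)
  have "inv_el (quad u z (x * x))" if uz: "\<bar>u\<bar> \<le> 1" "0 \<le> z" "z \<le> 1" for u z
  proof -
    obtain v where v: "\<bar>v\<bar> \<le> 1" "u = 2 * v\<^sup>2 - 1" by (rule half_angle[OF uz(1)])
    have "inv_el (quad v (sqrt z) x * quad (- v) (sqrt z) x)"
      using v uz by (intro inv_el_mult Suc.prems(1)) auto
    then show ?thesis using uz v quad_double[of v "sqrt z" x] by simp
  qed
  moreover have "z * z \<le> 1" using Suc.prems by (simp add: mult_le_one)
  ultimately show ?case using Suc.IH[of "x * x" u "z * z"] Suc.prems
    by (simp add: power_double del: power_Suc)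
qed simp

text \<open>
  Rickart's elementary route to the spectral radius formula: averages over roots of unity inherit
  the modulus of continuity of the resolvent, uniformly in \<open>n\<close>, so smallness of \<open>z x\<close> propagates
  in steps of fixed length from \<open>z = 0\<close> to \<open>z = 1\<close>.
\<close>

lemma quad_resolvent_equicont:
  assumes "\<And>u z. \<bar>u\<bar> \<le> 1 \<Longrightarrow> 0 \<le> z \<Longrightarrow> z \<le> 1 \<Longrightarrow> inv_el (quad u z x)"
    and "\<And>u. \<bar>u\<bar> \<le> 1 \<Longrightarrow> norm (quad_resolvent u z x - quad_resolvent u w x) \<le> e"
    and "0 \<le> z" "z \<le> 1" "0 \<le> w" "w \<le> 1" "\<bar>u\<bar> \<le> 1"
  shows "norm (quad_resolvent u (z ^ (2 ^ n)) (x ^ (2 ^ n)) - quad_resolvent u (w ^ (2 ^ n)) (x ^ (2 ^ n))) \<le> e"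
  using assms(7)
proof (induction n arbitrary: u)
  case 0 then show ?case using assms(2) by simp
next
  case (Suc n)
  obtain v where v: "\<bar>v\<bar> \<le> 1" "u = 2 * v\<^sup>2 - 1" by (rule half_angle[OF Suc.prems])
  let ?y = "x ^ (2 ^ n)" and ?z = "z ^ (2 ^ n)" and ?w = "w ^ (2 ^ n)"
  have p: "t ^ (2 ^ Suc n) = (t ^ (2 ^ n))\<^sup>2" for t :: real
    by (simp add: power_mult[symmetric] mult.commute)
  have px: "x ^ (2 ^ Suc n) = ?y * ?y" by (simp add: power_add[symmetric] mult_2)
  have i: "inv_el (quad v ?z ?y)" "inv_el (quad (- v) ?z ?y)" "inv_el (quad v ?w ?y)" "inv_el (quad (- v) ?w ?y)"
    using v assms by (auto intro!: quad_inv_power)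
  have "2 *\<^sub>R quad_resolvent u (?z\<^sup>2) (?y * ?y) - 2 *\<^sub>R quad_resolvent u (?w\<^sup>2) (?y * ?y)
     = (quad_resolvent v ?z ?y - quad_resolvent v ?w ?y) + (quad_resolvent (- v) ?z ?y - quad_resolvent (- v) ?w ?y)"
    unfolding v(2) quad_resolvent_double[OF i(1,2), symmetric] quad_resolvent_double[OF i(3,4), symmetric] by simp
  then have "2 * norm (quad_resolvent u (?z\<^sup>2) (?y * ?y) - quad_resolvent u (?w\<^sup>2) (?y * ?y))
    = norm ((quad_resolvent v ?z ?y - quad_resolvent v ?w ?y) + (quad_resolvent (- v) ?z ?y - quad_resolvent (- v) ?w ?y))"
    unfolding scaleR_diff_right[symmetric] by (metis abs_numeral norm_scaleR)
  also have "\<dots> \<le> e + e" using Suc.IH[of v] Suc.IH[of "- v"] v by (intro norm_triangle_mono) auto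
  finally show ?case unfolding p px by simp
qed

text \<open>At angle 0 the conjugate factors coincide and the mean is the plain inverse of
  \<open>1 - z y\<close>; only here does the size of \<open>y\<close> become visible.\<close>

lemma quad_resolvent_one:
  assumes "inv_el (quad 1 z y)" shows "quad_resolvent 1 z y * (1 - z *\<^sub>R y) = 1"
proof -
  have "quad 1 z y = (1 - z *\<^sub>R y) * (1 - z *\<^sub>R y)"
    unfolding quad_def by (simp add: algebra_simps power2_eq_square scaleR_2[symmetric])
  moreover have "iv (quad 1 z y) * (1 - z *\<^sub>R y) = (1 - z *\<^sub>R y) * iv (quad 1 z y)"
    using assms by (intro iv_commute) (simp_all add: calculation mult.assoc)
  ultimately show ?thesis unfolding quad_resolvent_def using iv[OF assms] by (simp add: mult.assoc)
qed

lemma small_step: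
  assumes Q: "\<And>u z. \<bar>u\<bar> \<le> 1 \<Longrightarrow> 0 \<le> z \<Longrightarrow> z \<le> 1 \<Longrightarrow> inv_el (quad u z x)"
    and F: "\<And>u. \<bar>u\<bar> \<le> 1 \<Longrightarrow> norm (quad_resolvent u z x - quad_resolvent u w x) \<le> 1 / 8"
    and zw: "0 \<le> z" "z \<le> 1" "0 \<le> w" "w \<le> 1" and s: "small (z *\<^sub>R x)"
  shows "small (w *\<^sub>R x)"
proof -
  \<comment> \<open>1/9 makes \<open>norm (?H - 1) \<le> 1/8\<close>; a step of 1/8 leaves
    \<open>norm (?H' - 1) \<le> 1/4\<close>, and then \<open>norm ?y' \<le> 1/3\<close>.\<close>
  obtain n where n: "norm ((z *\<^sub>R x) ^ (2 ^ n)) < 1 / 9"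
    using small_ex[OF s, of "1/9"] by auto
  let ?y = "(z *\<^sub>R x) ^ (2 ^ n)" and ?y' = "(w *\<^sub>R x) ^ (2 ^ n)"
  let ?H = "quad_resolvent 1 (z ^ (2 ^ n)) (x ^ (2 ^ n))" and ?H' = "quad_resolvent 1 (w ^ (2 ^ n)) (x ^ (2 ^ n))"
  have h: "?H * (1 - ?y) = 1" "?H' * (1 - ?y') = 1"
    using quad_resolvent_one[OF quad_inv_power[OF Q, of 1 _ n]] zw by (auto simp: scaleR_power)
  have "?H - 1 = ?y + (?H - 1) * ?y" using h by (simp add: algebra_simps)
  then have "norm (?H - 1) = norm (?y + (?H - 1) * ?y)" by (rule arg_cong)
  also have "\<dots> \<le> norm ?y + norm (?H - 1) * norm ?y"
    by (rule order_trans[OF norm_triangle_ineq add_left_mono[OF norm_mult_ineq]])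
  also have "\<dots> \<le> 1/9 + norm (?H - 1) * (1/9)"
    using n by (intro add_mono mult_left_mono) auto
  finally have a: "norm (?H - 1) \<le> 1/8" by simp
  have "norm (?H - ?H') \<le> 1/8" using quad_resolvent_equicont[OF Q F zw, of 1 n] by simp
  then have "norm (?H' - 1) \<le> 1/8 + 1/8"
    using a norm_triangle_ineq[of "?H' - ?H" "?H - 1"] by (simp add: norm_minus_commute)
  then have b: "norm (?H' - 1) \<le> 1/4" by simp
  have "?y' = (?H' - 1) - (?H' - 1) * ?y'" using h by (simp add: algebra_simps)
  then have "norm ?y' = norm ((?H' - 1) - (?H' - 1) * ?y')" by (rule arg_cong)
  also have "\<dots> \<le> norm (?H' - 1) + norm (?H' - 1) * norm ?y'"
    by (rule order_trans[OF norm_triangle_ineq4 add_left_mono[OF norm_mult_ineq]])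
  also have "\<dots> \<le> 1/4 + (1/4) * norm ?y'"
    using b by (intro add_mono mult_right_mono) auto
  finally have "norm ?y' < 1" by simp
  then show ?thesis unfolding small_def by blast
qed

text \<open>The hypothesis says in real terms that no complex spectral point has modulus at least 1.
  Compactness of the parameter rectangle provides the fixed step length.\<close>

lemma small_if_inv:
  assumes Q: "\<And>u z. \<bar>u\<bar> \<le> 1 \<Longrightarrow> 0 \<le> z \<Longrightarrow> z \<le> 1 \<Longrightarrow> inv_el (quad u z x)"
  shows "small x"
proof -
  let ?K = "{-1..1} \<times> {0..1::real}"
  have "continuous_on ?K (\<lambda>p. quad_resolvent (fst p) (snd p) x)"
    unfolding quad_resolvent_def
    by (intro continuous_intros continuous_on_iv)
       (auto simp: quad_def abs_le_iff intro!: continuous_intros Q[unfolded quad_def])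
  then have "uniformly_continuous_on ?K (\<lambda>p. quad_resolvent (fst p) (snd p) x)"
    by (intro compact_uniformly_continuous compact_Times compact_Icc)
  then obtain d where d: "d > 0" and
    dd: "\<And>p q. p \<in> ?K \<Longrightarrow> q \<in> ?K \<Longrightarrow> dist q p < d \<Longrightarrow>
       dist (quad_resolvent (fst q) (snd q) x) (quad_resolvent (fst p) (snd p) x) < 1/8"
    unfolding uniformly_continuous_on_def by (auto dest!: spec[of _ "1/8"])
  obtain m :: nat where m: "m > 0" "1 / real m < d"
    using d by (metis nat_approx_posE zero_less_Suc)
  have "j \<le> m \<Longrightarrow> small ((real j / real m) *\<^sub>R x)" for j
  proof (induction j)
    case 0 then show ?case by (auto simp: small_def power_0_left)
  next
    case (Suc j)
    show ?case
    proof (rule small_step[OF Q, where z="real j / real m"])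
      fix u :: real assume u: "\<bar>u\<bar> \<le> 1"
      have "dist (u, real j / m) (u, real (Suc j) / m) = \<bar>real j / m - real (Suc j) / m\<bar>"
        by (simp add: dist_Pair_Pair dist_real_def)
      also have "\<dots> = 1 / m" using m by (simp add: field_simps)
      finally have "dist (u, real j / m) (u, real (Suc j) / m) < d" using m by simp
      then have "dist (quad_resolvent u (real j / m) x) (quad_resolvent u (real (Suc j) / m) x) < 1/8"
        using dd[of "(u, real (Suc j) / m)" "(u, real j / m)"] u m Suc.prems by (auto simp: abs_le_iff)
      then show "norm (quad_resolvent u (real j / m) x - quad_resolvent u (real (Suc j) / m) x) \<le> 1/8"
        by (simp add: dist_norm)
    qed (use m Suc in \<open>auto simp: field_simps\<close>)
  qed
  from this[of m] show ?thesis using m by simp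
qed

section \<open>Square roots of hermitian elements\<close>

text \<open>The binomial series of the square root of \<open>1 - h\<close>. Its coefficients are
  bounded by 1, so summability of the powers of \<open>h\<close> suffices. The commutation clause
  will replace termwise adjoints.\<close>

lemma small_sqrt:
  fixes h :: "'a::{real_normed_algebra_1,banach}"
  assumes "small h"
  obtains b where "b * b = 1 - h" "\<And>z. z * h = h * z \<Longrightarrow> z * b = b * z"
proof -
  define a :: "nat \<Rightarrow> real" where "a n = (-1) ^ n * ((1/2) gchoose n)" for n
  have a1: "\<bar>a n\<bar> \<le> 1" for n
  proof (induction n)
    case (Suc n)
    have "real (Suc n) * ((1/2) gchoose Suc n) = (1/2 - real n) * ((1/2) gchoose n)"
      using gbinomial_mult_1[of "1/2 :: real" n] by (simp add: algebra_simps)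
    then have "((1/2) gchoose Suc n) = (1/2 - real n) / real (Suc n) * ((1/2) gchoose n)"
      by (simp add: field_simps)
    then have "\<bar>a (Suc n)\<bar> = \<bar>a n\<bar> * (\<bar>1/2 - real n\<bar> / real (Suc n))"
      by (simp add: a_def abs_mult abs_divide power_abs)
    also have "\<dots> \<le> 1 * 1" using Suc by (intro mult_mono) (auto simp: field_simps)
    finally show ?case by simp
  qed (simp add: a_def)
  have conv: "(\<Sum>i\<le>n. a i * a (n - i)) = (-1) ^ n * of_nat (1 choose n)" for n
  proof -
    have "(\<Sum>i\<le>n. a i * a (n - i)) = (\<Sum>i\<le>n. (-1) ^ n * (((1/2) gchoose i) * ((1/2) gchoose (n - i))))"
      by (intro sum.cong) (auto simp: a_def power_add[symmetric] mult_ac)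
    \<comment> \<open>Vandermonde with exponent 1/2 + 1/2 = 1 leaves just the coefficients of
      \<open>1 - t\<close>.\<close>
    also have "\<dots> = (-1) ^ n * ((1/2 + 1/2) gchoose n)"
      unfolding gbinomial_Vandermonde[symmetric] by (simp add: sum_distrib_left atLeast0AtMost)
    finally show ?thesis by (simp add: binomial_gbinomial)
  qed
  define b where "b = (\<Sum>n. a n *\<^sub>R h ^ n)"
  have s: "summable (\<lambda>n. norm (a n *\<^sub>R h ^ n))"
    by (rule summable_comparison_test'[OF small_summable[OF assms], of 0])
       (use a1 in \<open>auto intro: mult_left_le_one_le\<close>)
  have "b * b = (\<Sum>n. \<Sum>i\<le>n. (a i *\<^sub>R h ^ i) * (a (n - i) *\<^sub>R h ^ (n - i)))"
    unfolding b_def by (rule Cauchy_product[OF s s])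
  also have "(\<lambda>n. \<Sum>i\<le>n. (a i *\<^sub>R h ^ i) * (a (n - i) *\<^sub>R h ^ (n - i)))
     = (\<lambda>n. ((-1) ^ n * real (1 choose n)) *\<^sub>R h ^ n)"
    unfolding conv[symmetric] by (simp add: scaleR_sum_left power_add[symmetric] mult.commute)
  also have "(\<Sum>n. ((-1) ^ n * real (1 choose n)) *\<^sub>R h ^ n)
     = (\<Sum>n\<in>{0,1}. ((-1) ^ n * real (1 choose n)) *\<^sub>R h ^ n)"
    by (rule suminf_finite) (auto simp: binomial_eq_0)
  finally have "b * b = 1 - h" by simp
  moreover have "z * b = b * z" if z: "z * h = h * z" for z
  proof -
    have c: "z * h ^ n = h ^ n * z" for n by (metis z power_commuting_commutes)
    have "z * b = (\<Sum>n. z * (a n *\<^sub>R h ^ n))"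
      unfolding b_def by (rule suminf_mult[symmetric, OF summable_norm_cancel[OF s]])
    also have "\<dots> = (\<Sum>n. (a n *\<^sub>R h ^ n) * z)" by (simp add: c)
    also have "\<dots> = b * z"
      unfolding b_def by (rule suminf_mult2[symmetric, OF summable_norm_cancel[OF s]])
    finally show ?thesis .
  qed
  ultimately show thesis using that by blast
qed

lemma power_mult_commuting:
  fixes a b :: "'a::monoid_mult" assumes "a * b = b * a" shows "(a * b) ^ n = a ^ n * b ^ n"
proof (induction n)
  case (Suc n)
  have "b * a ^ n = a ^ n * b" by (metis assms power_commuting_commutes)
  then show ?case using Suc by (simp add: mult.assoc) (metis mult.assoc)
qed simp

lemma idem_small_zero:
  fixes f :: "'a::real_normed_algebra_1"
  assumes "f * f = f" "norm f < 1" shows "f = 0"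
proof (rule ccontr)
  assume "f \<noteq> 0"
  then have "norm f * norm f < norm f" using assms(2) by simp
  then show False using norm_mult_ineq[of f f] assms(1) by simp
qed

text \<open>The last two axioms keep \<open>\<i>\<close> and \<open>-\<i>\<close> out of the
  spectrum of a hermitian element and -1 out of that of a skew one; affine rescaling reaches all
  non-real, respectively all nonzero real points.\<close>

locale hermitian_star_algebra =
  fixes st :: "'u::{real_normed_algebra_1,banach} \<Rightarrow> 'u"
  assumes st_add: "st (x + y) = st x + st y"
    and st_scaleR: "st (c *\<^sub>R x) = c *\<^sub>R st x"
    and st_mult: "st (x * y) = st y * st x"
    and st_st [simp]: "st (st x) = x"
    and inv_one_plus_herm_sq: "st h = h \<Longrightarrow> inv_el (1 + h * h)"
    and inv_one_plus_skew: "st k = - k \<Longrightarrow> inv_el (1 + k)"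
begin

lemma st_0 [simp]: "st 0 = 0" using st_scaleR[of 0 0] by simp
lemma st_minus: "st (- x) = - st x" using st_scaleR[of "-1" x] by simp
lemma st_diff: "st (x - y) = st x - st y" using st_add[of x "- y"] by (simp add: st_minus)
lemma st_1 [simp]: "st 1 = 1" by (metis mult_1_left mult_1_right st_mult st_st)

lemmas st_simps = st_add st_scaleR st_mult st_minus st_diff

lemma inv_el_st: "inv_el x \<Longrightarrow> inv_el (st x)"
  by (metis inv_elI iv st_1 st_mult)

lemma iv_st: "inv_el x \<Longrightarrow> iv (st x) = st (iv x)"
  by (metis iv iv_unique st_1 st_mult)

lemma herm_quad_inv:
  assumes "st h = h" "\<bar>u\<bar> < 1" shows "inv_el (quad u z h)"
proof -
  \<comment> \<open>\<open>u\<close> and \<open>s\<close> are cosine and sine of one angle, and the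
    polynomial is the sum of squares \<open>(z h - u)^2 + s^2\<close>.\<close>
  define s where "s = sqrt (1 - u\<^sup>2)"
  have "u\<^sup>2 < 1" using assms(2) by (simp add: abs_square_less_1)
  then have s: "s \<noteq> 0" "s\<^sup>2 = 1 - u\<^sup>2" by (auto simp: s_def)
  define g where "g = (1 / s) *\<^sub>R (z *\<^sub>R h - u *\<^sub>R 1)"
  have "s\<^sup>2 *\<^sub>R (1 + g * g) = s\<^sup>2 *\<^sub>R 1 + (z *\<^sub>R h - u *\<^sub>R 1) * (z *\<^sub>R h - u *\<^sub>R 1)"
    using s(1) by (simp add: g_def scaleR_add_right power2_eq_square)
  also have "\<dots> = (s\<^sup>2 + u\<^sup>2) *\<^sub>R 1 - ((u * z) *\<^sub>R h + (u * z) *\<^sub>R h) + (z * z) *\<^sub>R (h * h)"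
    by (simp add: algebra_simps power2_eq_square)
  also have "\<dots> = quad u z h" unfolding quad_def s(2)
    by (simp add: scaleR_2[symmetric] power2_eq_square mult_ac)
  finally have "quad u z h = s\<^sup>2 *\<^sub>R (1 + g * g)" ..
  moreover have "st g = g" by (simp add: g_def st_simps assms)
  ultimately show ?thesis using s(1) by (metis inv_el_scaleR inv_one_plus_herm_sq power_eq_0_iff)
qed

lemma quad_one_inv:
  assumes "inv_el (1 - (z * u) *\<^sub>R x)" "u\<^sup>2 = 1" shows "inv_el (quad u z x)"
proof -
  have "z * u * (z * u) = z\<^sup>2" using assms(2) by (simp add: power2_eq_square mult_ac)
  then have "quad u z x = (1 - (z * u) *\<^sub>R x) * (1 - (z * u) *\<^sub>R x)"
    unfolding quad_def by (simp add: algebra_simps scaleR_2[symmetric])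
  then show ?thesis using assms by (simp add: inv_el_mult)
qed

text \<open>Non-real points are excluded by completing the square, so only the real ones, where the
  polynomial is a perfect square, remain as a hypothesis.\<close>

lemma herm_small:
  assumes "st h = h" and "\<And>t. \<bar>t\<bar> \<le> 1 \<Longrightarrow> inv_el (1 - t *\<^sub>R h)" shows "small h"
proof (rule small_if_inv)
  fix u z :: real assume u: "\<bar>u\<bar> \<le> 1" "0 \<le> z" "z \<le> 1"
  show "inv_el (quad u z h)"
  proof (cases "\<bar>u\<bar> < 1")
    case True then show ?thesis using herm_quad_inv assms(1) by blast
  next
    case False
    then have "\<bar>u\<bar> = 1" using u by simp
    then have "\<bar>z * u\<bar> \<le> 1" "u\<^sup>2 = 1" using u by (auto simp: abs_mult abs_square_eq_1)
    then show ?thesis using assms(2) quad_one_inv by blast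
  qed
qed

text \<open>
  The binomial series yields a root \<open>b\<close> that need not be hermitian a priori. As \<open>st b\<close> is a
  commuting root of the same element, \<open>v = st b * iv b\<close> is a hermitian involution. On the range of the
  idempotent \<open>f = (1 - v) / 2\<close> the element \<open>b\<close> is skew with positive square, so all
  multiples of \<open>f b\<close> have small spectral radius, which forces \<open>f = 0\<close>.
\<close>

lemma herm_sqrt:
  assumes h: "st h = h" "small h"
  obtains u where "st u = u" "u * u = 1 - h" "inv_el u"
proof -
  obtain b where b: "b * b = 1 - h" and bc: "\<And>z. z * h = h * z \<Longrightarrow> z * b = b * z"
    using small_sqrt[OF h(2)] by blast
  define y where "y = 1 - h"
  have y: "inv_el y" unfolding y_def using h(2) by (rule small_inv)
  have bb: "b * b = y" by (simp add: b y_def)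
  have ib: "inv_el b" using y bb by (intro inv_el_factor1[of b b]) auto
  define b' where "b' = st b"
  have b'b': "b' * b' = y" unfolding b'_def st_mult[symmetric] b by (simp add: st_diff h y_def)
  have ib': "inv_el b'" unfolding b'_def by (rule inv_el_st[OF ib])
  \<comment> \<open>Taking adjoints here shows that \<open>b'\<close> commutes with
    \<open>h\<close>, hence with \<open>b\<close>.\<close>
  have "b * h = h * b" using bc[of h] by simp
  then have "h * b' = b' * h" unfolding b'_def by (metis h(1) st_mult)
  then have c: "b' * b = b * b'" using bc[of b'] by simp
  have c': "b' * iv b = iv b * b'" using iv_commute[OF ib, of b'] c by simp
  define v where "v = b' * iv b"
  have vb: "v * b = b'" by (simp add: v_def mult.assoc iv ib)
  have bv: "b * v = b'" by (simp add: v_def c' iv_cancel ib)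
  have "st v = iv b' * b" unfolding v_def by (simp add: st_mult b'_def iv_st ib)
  also have "\<dots> = iv b' * (b * b) * iv b" by (simp add: mult.assoc iv ib)
  also have "\<dots> = iv b' * (b' * b') * iv b" by (simp add: bb b'b')
  also have "\<dots> = v" by (simp add: v_def mult.assoc iv_cancel ib')
  finally have sv: "st v = v" .
  have vv: "v * v = 1"
  proof -
    have "v * v = iv b * (b' * b') * iv b" by (simp add: v_def c' mult.assoc)
    also have "\<dots> = 1" unfolding b'b' bb[symmetric] by (simp add: mult.assoc iv iv_cancel ib)
    finally show ?thesis .
  qed
  define f where "f = (1 / 2) *\<^sub>R (1 - v)"
  have ff: "f * f = f"
  proof -
    have "(1 - v) * (1 - v) = 2 *\<^sub>R (1 - v)" using vv by (simp add: algebra_simps scaleR_2)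
    then show ?thesis unfolding f_def by simp
  qed
  have fb: "f * b = b * f" by (simp add: f_def algebra_simps vb bv)
  have vf: "v * f = - f" using vv by (simp add: f_def algebra_simps)
  have sf: "st f = f" by (simp add: f_def st_simps sv)
  define k where "k = f * b"
  have sk: "st k = - k"
  proof -
    have "st k = b' * f" by (simp add: k_def st_mult sf b'_def)
    also have "\<dots> = v * (b * f)" by (simp add: vb[symmetric] mult.assoc)
    also have "\<dots> = v * f * b" by (simp add: fb[symmetric] mult.assoc)
    finally show ?thesis by (simp add: vf k_def)
  qed
  have fy: "f * y = y * f" unfolding bb[symmetric] by (metis fb mult.assoc)
  have kk: "k * k = f * y"
    unfolding k_def bb[symmetric] by (metis fb ff mult.assoc)
  have inv0: "inv_el (1 + s *\<^sub>R (k * k))" if "s \<ge> 0" for s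
  proof -
    define w where "w = 1 + s *\<^sub>R y"
    have "small ((s / (1 + s)) *\<^sub>R h)" using that h(2) by (intro small_scaleR) (auto simp: field_simps)
    then have "inv_el ((1 + s) *\<^sub>R (1 - (s / (1 + s)) *\<^sub>R h))"
      using that by (intro inv_el_scaleR small_inv) auto
    moreover have "(1 + s) *\<^sub>R (1 - (s / (1 + s)) *\<^sub>R h) = w"
      using that by (simp add: w_def y_def scaleR_diff_right scaleR_add_left)
    ultimately have w: "inv_el w" by simp
    have wf: "w * f = f * w" by (simp add: w_def algebra_simps fy)
    have gf: "iv w * f = f * iv w" using iv_commute[OF w wf] .
    \<comment> \<open>Block form along the idempotent \<open>f\<close>: the identity on one block,
      the invertible \<open>w\<close> on the other.\<close>
    have e: "1 + s *\<^sub>R (k * k) = (1 - f) + f * w" by (simp add: kk w_def algebra_simps)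
    have f1: "f * (f * z) = f * z" for z by (metis ff mult.assoc)
    have f2: "w * (f * z) = f * (w * z)" "iv w * (f * z) = f * (iv w * z)" for z
      by (metis wf mult.assoc, metis gf mult.assoc)
    show ?thesis unfolding e
      by (rule inv_elI[of _ "(1 - f) + f * iv w" "(1 - f) + f * iv w"])
         (simp_all add: algebra_simps f1 f2 ff wf gf iv w)
  qed
  have sm: "small (R *\<^sub>R k)" for R
  proof (rule small_if_inv)
    fix u z :: real assume u: "\<bar>u\<bar> \<le> 1" "0 \<le> z" "z \<le> 1"
    let ?K = "R *\<^sub>R k"
    \<comment> \<open>A right angle is settled by \<open>inv0\<close>, angles 0 and \<pi> by the
      axiom on skew elements; otherwise doubling the angle passes to the hermitian
      \<open>?K * ?K\<close> with a cosine strictly between -1 and 1.\<close>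
    consider "u = 0" | "u\<^sup>2 = 1" | "u \<noteq> 0" "u\<^sup>2 < 1"
      using u(1) by (fastforce simp: abs_square_le_1[symmetric])
    then show "inv_el (quad u z ?K)"
    proof cases
      case 1
      then show ?thesis using inv0[of "z\<^sup>2 * (R * R)"] by (simp add: quad_def)
    next
      case 2
      have "inv_el (1 + (- (z * u * R)) *\<^sub>R k)"
        by (rule inv_one_plus_skew) (simp add: st_simps sk)
      then show ?thesis by (intro quad_one_inv 2) simp
    next
      case 3
      then have "u\<^sup>2 > 0" by simp
      then have "\<bar>2 * u\<^sup>2 - 1\<bar> < 1" using 3 by linarith
      then have "inv_el (quad (2 * u\<^sup>2 - 1) (z\<^sup>2) (?K * ?K))"
        by (intro herm_quad_inv) (auto simp: st_simps sk)
      then show ?thesis unfolding quad_double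
        by (rule inv_el_factor1) (rule quad_commute)
    qed
  qed
  \<comment> \<open>From \<open>f = k y^-1 k\<close> and commutation,
    \<open>f = f ^ N = k ^ N y^-N k ^ N\<close>. The factor \<open>R\<close> absorbs
    \<open>y^-N\<close>, so smallness of \<open>R k\<close> makes the norm of \<open>f\<close> less
    than 1.\<close>
  define R where "R = 1 + norm (iv y)"
  have R: "R \<ge> 1" "norm (iv y) \<le> R" by (auto simp: R_def)
  obtain n where n: "norm ((R *\<^sub>R k) ^ (2 ^ n)) < 1" using sm[of R] unfolding small_def by auto
  define N :: nat where "N = 2 ^ n"
  have "N > 0" by (simp add: N_def)
  then have fN: "f ^ N = f"
    by (induction N rule: nat_induct_non_zero) (simp_all add: ff)
  have "y * k = k * y" unfolding k_def bb[symmetric] by (metis fb mult.assoc)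
  then have c: "k * iv y = iv y * k" using iv_commute[OF y, of k] by simp
  then have c2: "(k * iv y) * k = k * (k * iv y)" by (metis mult.assoc)
  have "f = (k * iv y) * k"
    unfolding c2 by (simp add: mult.assoc[symmetric] kk) (simp add: mult.assoc iv y)
  moreover have "((k * iv y) * k) ^ N = (k ^ N * iv y ^ N) * k ^ N"
    by (simp add: power_mult_commuting[OF c2] power_mult_commuting[OF c])
  ultimately have "f = (k ^ N * iv y ^ N) * k ^ N" using fN by metis
  then have "norm f = norm ((k ^ N * iv y ^ N) * k ^ N)" by (rule arg_cong)
  also have "\<dots> \<le> (norm (k ^ N) * norm (iv y ^ N)) * norm (k ^ N)"
    by (meson norm_mult_ineq norm_ge_zero mult_right_mono order_trans)
  also have "\<dots> \<le> (norm (k ^ N) * R ^ N) * norm (k ^ N)"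
  proof -
    have "norm (iv y ^ N) \<le> R ^ N"
      by (rule order_trans[OF norm_power_ineq power_mono[OF R(2)]]) simp
    then show ?thesis by (intro mult_right_mono mult_left_mono) auto
  qed
  also have "\<dots> \<le> (R ^ N * norm (k ^ N)) * (R ^ N * norm (k ^ N))"
  proof -
    have "1 * norm (k ^ N) \<le> R ^ N * norm (k ^ N)"
      using R(1) by (intro mult_right_mono one_le_power) auto
    then have "R ^ N * norm (k ^ N) * norm (k ^ N) \<le> R ^ N * norm (k ^ N) * (R ^ N * norm (k ^ N))"
      using R(1) by (intro mult_left_mono) auto
    then show ?thesis by (simp add: mult_ac)
  qed
  also have "\<dots> < 1 * 1"
  proof -
    have "R ^ N * norm (k ^ N) < 1" using n R(1) by (simp add: scaleR_power N_def)
    then show ?thesis using R(1) by (intro mult_strict_mono') auto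
  qed
  finally have "f = 0" using idem_small_zero[OF ff] by simp
  then have "v = 1" by (simp add: f_def)
  then have "st b = b" using vb by (simp add: b'_def)
  then show thesis using that b ib by blast
qed

end

section \<open>Positivity of hermitian elements\<close>

context hermitian_star_algebra
begin

text \<open>Congruence by the hermitian \<open>iv u\<close> keeps \<open>k\<close> skew and turns
  the square into 1.\<close>

lemma inv_el_sq_plus_skew:
  assumes "st u = u" "inv_el u" "st k = - k" shows "inv_el (u * u + k)"
proof -
  have "st (iv u) = iv u" using iv_st[OF assms(2)] assms(1) by simp
  then have "inv_el (1 + iv u * k * iv u)"
    by (intro inv_one_plus_skew) (simp add: st_simps assms mult.assoc)
  then have "inv_el (u * (1 + iv u * k * iv u) * u)"
    by (intro inv_el_mult assms)
  also have "u * (1 + iv u * k * iv u) * u = u * u + k"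
    by (simp add: algebra_simps iv iv_cancel assms)
  finally show ?thesis .
qed

text \<open>\<open>(1 + st x) (1 - x)\<close> is \<open>1 - st x * x\<close>, a square by
  \<open>herm_sqrt\<close>, plus a skew element. This gives a left inverse; the right one needs the
  opposite product and hence \<open>small_swap\<close>.\<close>

lemma inv_el_one_minus_if_small_star:
  assumes "small (st x * x)" shows "inv_el (1 - x)"
proof -
  obtain u where "st u = u" "u * u = 1 - st x * x" "inv_el u"
    using herm_sqrt[OF _ assms] by (auto simp: st_mult)
  then have 1: "inv_el ((1 - st x * x) + (st x - x))"
    using inv_el_sq_plus_skew[of u "st x - x"] by (simp add: st_simps)
  obtain v where "st v = v" "v * v = 1 - x * st x" "inv_el v"
    using herm_sqrt[OF _ small_swap[OF assms]] by (auto simp: st_mult)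
  then have 2: "inv_el ((1 - x * st x) + (st x - x))"
    using inv_el_sq_plus_skew[of v "st x - x"] by (simp add: st_simps)
  show ?thesis
  proof (rule inv_el_factors)
    show "inv_el ((1 - x) * (1 + st x))" using 2 by (simp add: algebra_simps)
    show "inv_el ((1 + st x) * (1 - x))" using 1 by (simp add: algebra_simps)
  qed
qed

text \<open>
  For \<open>x = p q\<close> one has \<open>st x * x = q p p q\<close>, and passing from \<open>(p, q)\<close> to \<open>(p\<^sup>2, q\<^sup>2)\<close> reduces
  smallness of this element to smallness of large powers of \<open>p\<close> and \<open>q\<close>.
\<close>

lemma small_herm_product_step:
  assumes p: "st p = p" and q: "st q = q"
    and s: "small (q * q * (p * p) * (p * p) * (q * q))"
  shows "small (q * p * p * q)"
proof (rule herm_small)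
  show "st (q * p * p * q) = q * p * p * q" by (simp add: st_mult p q mult.assoc)
  fix t :: real assume t: "\<bar>t\<bar> \<le> 1"
  let ?x = "t *\<^sub>R (p * p * (q * q))"
  have "small ((t * t) *\<^sub>R (q * q * (p * p) * (p * p) * (q * q)))"
    using mult_le_one[OF t _ t] by (intro small_scaleR s) (simp add: abs_mult[symmetric])
  then have "small (st ?x * ?x)"
    by (simp add: st_simps p q mult.assoc)
  then have "inv_el (1 - ?x)" by (rule inv_el_one_minus_if_small_star)
  \<comment> \<open>Moving the last \<open>q\<close> to the front turns \<open>p p q q\<close> into
    the hermitian \<open>q p p q\<close>.\<close>
  then have "inv_el (1 + ((- t) *\<^sub>R (p * p * q)) * q)" by (simp add: mult.assoc)
  then have "inv_el (1 + q * ((- t) *\<^sub>R (p * p * q)))" by (rule inv_el_one_plus_swap)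
  then show "inv_el (1 - t *\<^sub>R (q * p * p * q))" by (simp add: mult.assoc)
qed

lemma small_herm_product_power:
  assumes "st p = p" "st q = q"
    and "small (q ^ (2 ^ n) * p ^ (2 ^ n) * p ^ (2 ^ n) * q ^ (2 ^ n))"
  shows "small (q * p * p * q)"
  using assms
proof (induction n arbitrary: p q)
  case (Suc n)
  have "small (q * q * (p * p) * (p * p) * (q * q))"
  proof -
    have "small (q * q * (p * p) * (p * p) * (q * q))"
      using Suc.IH[of "p * p" "q * q"] Suc.prems
      by (simp only: power_double st_mult mult.assoc)
    then show ?thesis .
  qed
  then show ?case using small_herm_product_step Suc.prems(1,2) by blast
qed simp

lemma inv_el_one_minus_herm_product:
  assumes "st p = p" "st q = q" "small p" "small q" shows "inv_el (1 - p * q)"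
proof -
  obtain n1 n2 where n1: "\<And>n. n \<ge> n1 \<Longrightarrow> norm (p ^ (2 ^ n)) < 1"
    and n2: "\<And>n. n \<ge> n2 \<Longrightarrow> norm (q ^ (2 ^ n)) < 1"
    using small_ex[OF assms(3), of 1] small_ex[OF assms(4), of 1] by auto
  define n where "n = max n1 n2"
  let ?p = "p ^ (2 ^ n)" and ?q = "q ^ (2 ^ n)"
  have lt: "norm ?p < 1" "norm ?q < 1" by (simp_all add: n1 n2 n_def)
  have m: "norm (a * b) < 1" if "norm a < 1" "norm b < 1" for a b :: 'u
  proof -
    have "norm a * norm b < 1 * 1" using that by (intro mult_strict_mono') auto
    then show ?thesis using norm_mult_ineq[of a b] by linarith
  qed
  have "norm ((?q * ?p * ?p * ?q) ^ (2 ^ 0)) < 1" by (simp add: m lt)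
  then have "small (?q * ?p * ?p * ?q)" unfolding small_def by blast
  then have "small (q * p * p * q)" using small_herm_product_power assms by blast
  then have "small (st (p * q) * (p * q))" by (simp add: st_mult assms mult.assoc)
  then show ?thesis by (rule inv_el_one_minus_if_small_star)
qed

text \<open>Spectrum in [0, \<infinity>): for hermitian elements only negative real points need
  exclusion. Strict \<open>s > 0\<close> admits singular elements.\<close>

definition pos :: "'u \<Rightarrow> bool" where
  "pos x \<longleftrightarrow> st x = x \<and> (\<forall>s>0. inv_el (x + s *\<^sub>R 1))"

text \<open>The Cayley transform carries positive invertible elements into the open unit ball of the
  spectral radius: \<open>1 - t g\<close> is \<open>(1 + t) x + (1 - t)\<close> divided by
  \<open>1 + x\<close>.\<close>

lemma cayley_small:
  assumes x: "st x = x" "\<And>s. s \<ge> 0 \<Longrightarrow> inv_el (x + s *\<^sub>R 1)"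
  defines "g \<equiv> (1 - x) * iv (1 + x)"
  shows "st g = g" "small g" "iv (1 + x) * (1 - x) = g" "inv_el (1 + x)"
proof -
  show i: "inv_el (1 + x)" using x(2)[of 1] by (simp add: add.commute)
  show c: "iv (1 + x) * (1 - x) = g"
    unfolding g_def by (rule iv_commute[OF i]) (simp add: algebra_simps)
  show sg: "st g = g"
    using iv_st[OF i] c by (simp add: g_def st_simps x)
  show "small g"
  proof (rule herm_small[OF sg])
    fix t :: real assume t: "\<bar>t\<bar> \<le> 1"
    have e: "1 - t *\<^sub>R g = ((1 + x) - t *\<^sub>R (1 - x)) * iv (1 + x)"
      by (simp add: left_diff_distrib iv i g_def)
    have "inv_el ((1 + x) - t *\<^sub>R (1 - x))"
    proof (cases "t = -1")
      case True
      then have "(1 + x) - t *\<^sub>R (1 - x) = 2 *\<^sub>R 1" by (simp add: scaleR_2)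
      then show ?thesis by (simp add: inv_el_scaleR inv_el_1)
    next
      case False
      then have t': "1 + t > 0" using t by auto
      have "(1 + x) - t *\<^sub>R (1 - x) = (1 + t) *\<^sub>R x + (1 - t) *\<^sub>R 1" by (simp add: algebra_simps)
      also have "\<dots> = (1 + t) *\<^sub>R (x + ((1 - t) / (1 + t)) *\<^sub>R 1)"
        using t' by (simp add: scaleR_add_right)
      finally show ?thesis using t t' by (simp add: inv_el_scaleR x(2))
    qed
    then show "inv_el (1 - t *\<^sub>R g)" unfolding e by (intro inv_el_mult inv_el_iv i)
  qed
qed

text \<open>\<open>2 (x + y) = (1 + x) (1 + y) - (1 - x) (1 - y)\<close>, and the right side is
  \<open>(1 + x) (1 - g g') (1 + y)\<close>. As \<open>x\<close> and \<open>y\<close> need not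
  commute, \<open>g\<close> is read with its inverse on the left and \<open>g'\<close> with it on
  the right.\<close>

lemma inv_el_add:
  assumes "st x = x" "\<And>s. s \<ge> 0 \<Longrightarrow> inv_el (x + s *\<^sub>R 1)"
    and "st y = y" "\<And>s. s \<ge> 0 \<Longrightarrow> inv_el (y + s *\<^sub>R 1)"
  shows "inv_el (x + y)"
proof -
  define g where "g = (1 - x) * iv (1 + x)"
  define g' where "g' = (1 - y) * iv (1 + y)"
  note x = cayley_small[OF assms(1,2), folded g_def] and y = cayley_small[OF assms(3,4), folded g'_def]
  have "inv_el ((1 + x) * (1 - g * g') * (1 + y))"
    by (intro inv_el_mult x y inv_el_one_minus_herm_product)
  also have "(1 + x) * (1 - g * g') * (1 + y) = (1 + x) * (1 + y) - ((1 + x) * g) * (g' * (1 + y))"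
    by (simp add: algebra_simps)
  also have "(1 + x) * g = 1 - x" using iv_cancel(1)[OF x(4)] by (metis x(3))
  also have "g' * (1 + y) = 1 - y" by (simp add: g'_def mult.assoc iv y(4))
  also have "(1 + x) * (1 + y) - (1 - x) * (1 - y) = 2 *\<^sub>R (x + y)"
    by (simp add: algebra_simps scaleR_2)
  finally show ?thesis by (simp add: inv_el_scaleR_iff)
qed

lemma pos_add: assumes "pos x" "pos y" shows "pos (x + y)"
  unfolding pos_def
proof (intro conjI allI impI)
  show "st (x + y) = x + y" using assms by (simp add: pos_def st_add)
  fix s :: real assume s: "s > 0"
  have "inv_el ((x + (s/2) *\<^sub>R 1) + (y + (s/2) *\<^sub>R 1))"
    by (rule inv_el_add) (use assms s in \<open>auto simp: pos_def st_simps add.assoc simp flip: scaleR_add_left\<close>)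
  also have "(x + (s/2) *\<^sub>R 1) + (y + (s/2) *\<^sub>R 1) = (x + y) + (s/2 + s/2) *\<^sub>R 1"
    by (simp only: scaleR_add_left ac_simps)
  finally show "inv_el (x + y + s *\<^sub>R 1)" by simp
qed

lemma pos_0: "pos 0" by (simp add: pos_def inv_el_scaleR inv_el_1)

lemma pos_scaleR: assumes "pos x" "c \<ge> 0" shows "pos (c *\<^sub>R x)"
proof (cases "c = 0")
  case False
  then have c: "c > 0" using assms by simp
  have "inv_el (c *\<^sub>R x + s *\<^sub>R 1)" if "s > 0" for s
  proof -
    have "c *\<^sub>R x + s *\<^sub>R 1 = c *\<^sub>R (x + (s / c) *\<^sub>R 1)" using c by (simp add: scaleR_add_right)
    then show ?thesis using assms that c by (simp add: inv_el_scaleR pos_def)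
  qed
  then show ?thesis using assms by (simp add: pos_def st_scaleR)
qed (simp add: pos_0)

lemma pos_herm_sq: assumes "st h = h" shows "pos (h * h)"
proof -
  have "inv_el (h * h + s *\<^sub>R 1)" if s: "s > 0" for s
  proof -
    let ?h = "(1 / sqrt s) *\<^sub>R h"
    have "h * h + s *\<^sub>R 1 = s *\<^sub>R (1 + ?h * ?h)" using s by (simp add: scaleR_add_right)
    then show ?thesis using s assms by (simp add: inv_el_scaleR inv_one_plus_herm_sq st_scaleR del: mult_scaleR_left mult_scaleR_right)
  qed
  then show ?thesis using assms by (simp add: pos_def st_mult)
qed

lemma pos_skew_sq: assumes "st k = - k" shows "pos (- (k * k))"
proof -
  have "inv_el (- (k * k) + s *\<^sub>R 1)" if s: "s > 0" for s
  proof -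
    let ?k = "(1 / sqrt s) *\<^sub>R k"
    have "inv_el (1 + ?k)" by (rule inv_one_plus_skew) (simp add: st_simps assms)
    moreover have "inv_el (1 + - ?k)" by (rule inv_one_plus_skew) (simp add: st_simps assms)
    ultimately have "inv_el (s *\<^sub>R ((1 + ?k) * (1 + - ?k)))" using s by (intro inv_el_scaleR inv_el_mult) auto
    moreover have "- (k * k) + s *\<^sub>R 1 = s *\<^sub>R ((1 + ?k) * (1 + - ?k))"
      using s by (simp add: algebra_simps)
    ultimately show ?thesis by simp
  qed
  then show ?thesis using assms by (simp add: pos_def st_simps)
qed

text \<open>Makes 1 an order unit with a bound by the norm; this later keeps the dominating
  functional finite and the extension bounded.\<close>

lemma pos_norm:
  assumes "st h = h" "norm h \<le> r" shows "pos (r *\<^sub>R 1 - h)"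
proof -
  have "inv_el (r *\<^sub>R 1 - h + s *\<^sub>R 1)" if s: "s > 0" for s
  proof -
    have rs: "r + s > 0" using s assms(2) norm_ge_zero[of h] by linarith
    have "norm ((1 / (r + s)) *\<^sub>R h) < 1" using rs s assms(2) by (simp add: field_simps)
    then have "inv_el ((r + s) *\<^sub>R (1 - (1 / (r + s)) *\<^sub>R h))"
      using rs by (intro inv_el_scaleR inv_el_one_minus) auto
    moreover have "r *\<^sub>R 1 - h + s *\<^sub>R 1 = (r + s) *\<^sub>R (1 - (1 / (r + s)) *\<^sub>R h)"
      using rs by (simp add: scaleR_diff_right scaleR_add_left)
    ultimately show ?thesis by simp
  qed
  then show ?thesis using assms by (simp add: pos_def st_simps)
qed

text \<open>
  For \<open>y = st x * x\<close> and \<open>b = 2 x (1 + y)\<^bsup>-1\<^esup>\<close>, both \<open>1 - st b * b = ((1 - y) (1 + y)\<^bsup>-1\<^esup>)\<^sup>2\<close> and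
  \<open>b * st b + st b * b\<close> are positive, hence so are \<open>1 + b * st b\<close> and \<open>1 + st b * b\<close>; the latter keeps
  the spectrum of \<open>y\<close> farther from \<open>-1\<close> than assumed.
\<close>

lemma pos_star_step:
  assumes i: "\<And>t. 0 \<le> t \<Longrightarrow> t \<le> 1 \<Longrightarrow> inv_el (1 + t *\<^sub>R (st x * x))"
    and a: "0 \<le> a" "a \<le> 2"
  shows "inv_el (1 + a *\<^sub>R (st x * x))"
proof (cases "a \<le> 1")
  case True then show ?thesis using i a by blast
next
  case False
  define y where "y = st x * x"
  define w where "w = iv (1 + y)"
  have sy: "st y = y" by (simp add: y_def st_mult)
  have iy: "inv_el (1 + y)" using i[of 1] by (simp add: y_def)
  have sw: "st w = w" using iv_st[OF iy] by (simp add: w_def st_simps sy)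
  have wy: "w * y = y * w" unfolding w_def by (rule iv_commute[OF iy]) (simp add: algebra_simps)
  have w1: "y * w = 1 - w" using iv[OF iy] by (simp add: w_def algebra_simps)
  define b where "b = 2 *\<^sub>R (x * w)"
  have bb: "st b * b = 4 *\<^sub>R (w * y * w)" by (simp add: b_def st_simps sw y_def mult.assoc)
  define g where "g = (1 - y) * w"
  have "st g = g" by (simp add: g_def st_simps sy sw algebra_simps wy)
  then have "pos (g * g)" by (rule pos_herm_sq)
  also have "g * g = 1 - st b * b"
  proof -
    have g: "g = 2 *\<^sub>R w - 1" by (simp add: g_def algebra_simps w1 scaleR_2)
    have 4: "4 *\<^sub>R z = 2 *\<^sub>R z + 2 *\<^sub>R z" for z :: 'u
      by (simp flip: scaleR_add_left)
    have "g * g = 1 - 4 *\<^sub>R (w * (1 - w))" unfolding 4 by (simp add: g algebra_simps scaleR_2)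
    then show ?thesis by (simp add: bb mult.assoc w1)
  qed
  finally have pos1: "pos (1 - st b * b)" .
  \<comment> \<open>Twice the real part and twice \<open>\<i>\<close> times the imaginary part of
    \<open>b\<close>; their squares express \<open>b * st b + st b * b\<close>.\<close>
  define h where "h = b + st b"
  define k where "k = b - st b"
  have "pos ((1/2) *\<^sub>R (h * h + - (k * k)))"
    by (intro pos_scaleR pos_add pos_herm_sq pos_skew_sq) (auto simp: h_def k_def st_simps)
  also have "h * h + - (k * k) = 2 *\<^sub>R (b * st b + st b * b)"
    by (simp add: h_def k_def algebra_simps scaleR_2)
  finally have "pos (b * st b + st b * b)" by simp
  from pos_add[OF this pos1] have pos2: "pos (1 + b * st b)" by (simp add: algebra_simps)
  \<comment> \<open>The goal is a factor of \<open>(1 + a y) (1 + y / a) = (1 + y)^2 + c y\<close>,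
    which forces \<open>c = a + 1/a - 2\<close>. Dividing by \<open>1 + y\<close> on both sides
    leaves \<open>1 + c w y w = 1 + (c / 4) st b * b\<close>; \<open>c < 4\<close> makes the shift
    \<open>4 / c - 1\<close> positive.\<close>
  define c where "c = (a - 1)\<^sup>2 / a"
  have a0: "a > 0" "a - 1 > 0" using False by auto
  have c: "0 < c" "c < 4"
  proof -
    show "0 < c" using a0 by (simp add: c_def)
    have "(a - 1)\<^sup>2 \<le> 1\<^sup>2" using a0 a by (intro power_mono) auto
    then have "(a - 1)\<^sup>2 < 4 * a" using False by simp
    then show "c < 4" using a0 by (simp add: c_def field_simps)
  qed
  have "inv_el (1 + b * st b + (4 / c - 1) *\<^sub>R 1)"
    using pos2 c by (auto simp: pos_def)
  then have "inv_el ((c / 4) *\<^sub>R (1 + b * st b + (4 / c - 1) *\<^sub>R 1))" using c by (simp add: inv_el_scaleR)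
  also have "(c / 4) *\<^sub>R (1 + b * st b + (4 / c - 1) *\<^sub>R 1) = 1 + ((c / 4) *\<^sub>R b) * st b"
    using c by (simp add: algebra_simps)
  finally have "inv_el (1 + st b * ((c / 4) *\<^sub>R b))" by (rule inv_el_one_plus_swap)
  also have "st b * ((c / 4) *\<^sub>R b) = c *\<^sub>R (w * y * w)" by (simp add: bb)
  finally have "inv_el ((1 + y) * (1 + c *\<^sub>R (w * y * w)) * (1 + y))"
    by (intro inv_el_mult iy)
  also have "(1 + y) * (1 + c *\<^sub>R (w * y * w)) * (1 + y)
     = (1 + y) * (1 + y) + c *\<^sub>R (((1 + y) * w) * y * (w * (1 + y)))"
    by (simp add: algebra_simps)
  also have "\<dots> = (1 + y) * (1 + y) + c *\<^sub>R y" by (simp add: w_def iv iy)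
  also have "\<dots> = 1 + (2 + c) *\<^sub>R y + y * y" by (simp add: algebra_simps scaleR_2)
  also have "2 + c = a + 1 / a" using a0 by (simp add: c_def field_simps power2_eq_square)
  also have "1 + (a + 1 / a) *\<^sub>R y + y * y = (1 + a *\<^sub>R y) * (1 + (1 / a) *\<^sub>R y)"
    using a0 by (simp add: algebra_simps)
  finally show ?thesis unfolding y_def[symmetric]
    by (rule inv_el_factor1) (simp add: algebra_simps)
qed

text \<open>The Neumann series starts the argument for small \<open>t\<close>; applied to
  \<open>sqrt r *\<^sub>R x\<close>, \<open>pos_star_step\<close> doubles the admissible range of
  \<open>t\<close> each time.\<close>

lemma pos_star: "pos (st x * x)"
proof -
  define y where "y = st x * x"
  define T where "T = 1 / (2 * (norm y + 1))"
  have T: "T > 0" by (simp add: T_def add_nonneg_pos)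
  have "0 \<le> t \<Longrightarrow> t \<le> 2 ^ n * T \<Longrightarrow> inv_el (1 + t *\<^sub>R y)" for n t
  proof (induction n arbitrary: t)
    case 0
    have "norm (t *\<^sub>R y) \<le> T * norm y" using 0 by (simp add: mult_right_mono)
    also have "\<dots> < 1"
    proof -
      have "2 * (norm y + 1) > 0" by (simp add: add_nonneg_pos)
      then show ?thesis by (simp add: T_def divide_less_eq)
    qed
    finally have "inv_el (1 - (- t) *\<^sub>R y)" by (intro inv_el_one_minus) simp
    then show ?case by simp
  next
    case (Suc n)
    define r where "r = 2 ^ n * T"
    have r: "r > 0" using T by (simp add: r_def)
    let ?x = "sqrt r *\<^sub>R x"
    have sx: "st ?x * ?x = r *\<^sub>R y" using r by (simp add: st_simps y_def)
    have "inv_el (1 + (t / r) *\<^sub>R (st ?x * ?x))"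
    proof (rule pos_star_step)
      fix s :: real assume "0 \<le> s" "s \<le> 1"
      then have "inv_el (1 + (s * r) *\<^sub>R y)"
        using r by (intro Suc.IH) (auto simp: r_def[symmetric])
      then show "inv_el (1 + s *\<^sub>R (st ?x * ?x))" unfolding sx by simp
    qed (use r Suc.prems in \<open>auto simp: r_def field_simps\<close>)
    then show ?case using r unfolding sx by simp
  qed note P = this
  have "inv_el (y + s *\<^sub>R 1)" if s: "s > 0" for s
  proof -
    obtain n where "(1 / s) / T < 2 ^ n" using real_arch_pow[of 2 "(1 / s) / T"] by auto
    then have "inv_el (1 + (1 / s) *\<^sub>R y)" using s T by (intro P[of _ n]) (auto simp: field_simps)
    then have "inv_el (s *\<^sub>R (1 + (1 / s) *\<^sub>R y))" using s by (simp add: inv_el_scaleR)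
    then show ?thesis using s by (simp add: scaleR_add_right add.commute)
  qed
  then show ?thesis unfolding y_def by (simp add: pos_def st_mult)
qed

text \<open>The spectrum of \<open>d\<close> lies in [0, t], hence so does that of
  \<open>t - d\<close>. For \<open>s > 0\<close> positivity of \<open>d\<close> is used, for
  \<open>s \<le> 0\<close> its norm.\<close>

lemma pos_small:
  assumes d: "pos d" "norm d \<le> t" and t': "t < t'"
  shows "small ((1 / t') *\<^sub>R (t *\<^sub>R 1 - d))"
proof (rule herm_small)
  have t: "t \<ge> 0" using d(2) norm_ge_zero[of d] by linarith
  have sd: "st d = d" using d by (simp add: pos_def)
  show "st ((1 / t') *\<^sub>R (t *\<^sub>R 1 - d)) = (1 / t') *\<^sub>R (t *\<^sub>R 1 - d)" by (simp add: st_simps sd)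
  fix s :: real assume s: "\<bar>s\<bar> \<le> 1"
  have e: "1 - s *\<^sub>R ((1 / t') *\<^sub>R (t *\<^sub>R 1 - d)) = (1 / t') *\<^sub>R ((t' - s * t) *\<^sub>R 1 + s *\<^sub>R d)"
    using t t' by (simp add: algebra_simps)
  have st: "\<bar>s * t\<bar> \<le> t" using s t by (simp add: abs_mult mult_left_le_one_le)
  then have pp: "t' - s * t > 0" using t' by linarith
  have "inv_el ((t' - s * t) *\<^sub>R 1 + s *\<^sub>R d)"
  proof (cases "s > 0")
    case True
    then have "inv_el (s *\<^sub>R (d + ((t' - s * t) / s) *\<^sub>R 1))"
      using pp d(1) by (intro inv_el_scaleR) (auto simp: pos_def)
    then show ?thesis using True by (simp add: scaleR_add_right add.commute)
  next
    case False
    have "norm ((- s) *\<^sub>R d) \<le> (- s) * t" using False d(2) using mult_left_mono[of "norm d" t "- s"] by simp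
    then have "norm ((- s) *\<^sub>R d) < t' - s * t" using t t' by simp
    then have "norm ((1 / (t' - s * t)) *\<^sub>R ((- s) *\<^sub>R d)) < 1" using pp by (simp add: field_simps)
    then have "inv_el ((t' - s * t) *\<^sub>R (1 - (1 / (t' - s * t)) *\<^sub>R ((- s) *\<^sub>R d)))"
      using pp by (intro inv_el_scaleR inv_el_one_minus) auto
    then show ?thesis using pp by (simp add: scaleR_diff_right scaleR_add_right)
  qed
  then show "inv_el (1 - s *\<^sub>R ((1 / t') *\<^sub>R (t *\<^sub>R 1 - d)))"
    unfolding e using t t' by (intro inv_el_scaleR) auto
qed

end

section \<open>Sublinear functionals and the unitization\<close>

definition sublinear :: "('a::real_vector \<Rightarrow> real) \<Rightarrow> bool" where
  "sublinear p \<longleftrightarrow> (\<forall>x y. p (x + y) \<le> p x + p y) \<and> (\<forall>c>0. \<forall>x. p (c *\<^sub>R x) \<le> c * p x)"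

lemma sublinearI:
  "(\<And>x y. p (x + y) \<le> p x + p y) \<Longrightarrow> (\<And>c x. c > 0 \<Longrightarrow> p (c *\<^sub>R x) \<le> c * p x) \<Longrightarrow> sublinear p"
  by (simp add: sublinear_def)

lemma sublinear_add: "sublinear p \<Longrightarrow> p (x + y) \<le> p x + p y"
  by (simp add: sublinear_def)

lemma sublinear_scaleR: assumes "sublinear p" "c > 0" shows "p (c *\<^sub>R x) = c * p x"
proof (rule antisym)
  show "p (c *\<^sub>R x) \<le> c * p x" using assms by (simp add: sublinear_def)
  have "p ((1 / c) *\<^sub>R (c *\<^sub>R x)) \<le> (1 / c) * p (c *\<^sub>R x)"
    using assms unfolding sublinear_def by (meson divide_pos_pos zero_less_one)
  then show "c * p x \<le> p (c *\<^sub>R x)" using assms(2) by (simp add: field_simps)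
qed

lemma sublinear_0: assumes "sublinear p" shows "p 0 = 0"
  using sublinear_scaleR[OF assms, of 2 0] by simp

lemma sublinear_neg: assumes "sublinear p" shows "- p (- x) \<le> p x"
  using sublinear_add[OF assms, of x "- x"] sublinear_0[OF assms] by simp

text \<open>The pointwise infimum is finite since \<open>- p (- x)\<close> bounds every member from
  below; it is subadditive because two members of a chain have a common lower one.\<close>

lemma sublinear_chain_lower_bound:
  fixes C :: "('a::real_vector \<Rightarrow> real) set"
  assumes ne: "C \<noteq> {}" and C: "\<And>q. q \<in> C \<Longrightarrow> sublinear q \<and> (\<forall>x. q x \<le> p x)"
    and chain: "\<And>q r. q \<in> C \<Longrightarrow> r \<in> C \<Longrightarrow> (\<forall>x. q x \<le> r x) \<or> (\<forall>x. r x \<le> q x)"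
  shows "\<exists>u. sublinear u \<and> (\<forall>q\<in>C. \<forall>x. u x \<le> q x)"
proof -
  define u where "u x = (INF q\<in>C. q x)" for x
  have bd: "bdd_below ((\<lambda>q. q x) ` C)" for x
  proof (rule bdd_belowI2)
    fix q assume "q \<in> C"
    then show "- p (- x) \<le> q x" using C[of q] sublinear_neg[of q x]
      by (meson neg_le_iff_le order_trans)
  qed
  have lb: "u x \<le> q x" if "q \<in> C" for q x unfolding u_def by (rule cINF_lower[OF bd that])
  have "sublinear u"
  proof (rule sublinearI)
    fix x y
    have *: "u (x + y) \<le> q x + r y" if "q \<in> C" "r \<in> C" for q r
    proof -
      have "\<exists>s\<in>C. s x \<le> q x \<and> s y \<le> r y" using chain[OF that] that by blast
      then obtain s where s: "s \<in> C" "s x \<le> q x" "s y \<le> r y" by blast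
      have "u (x + y) \<le> s (x + y)" by (rule lb[OF s(1)])
      also have "\<dots> \<le> s x + s y" using C[OF s(1)] sublinear_add by blast
      finally show ?thesis using s by linarith
    qed
    have "u (x + y) - q x \<le> u y" if "q \<in> C" for q
      unfolding u_def[of y] by (rule cINF_greatest[OF ne]) (use *[OF that] in force)
    then have "u (x + y) - u y \<le> u x"
      unfolding u_def[of x] by (intro cINF_greatest[OF ne]) force
    then show "u (x + y) \<le> u x + u y" by simp
  next
    fix c :: real and x assume c: "c > 0"
    have "u (c *\<^sub>R x) / c \<le> u x" unfolding u_def[of x]
    proof (rule cINF_greatest[OF ne])
      fix q assume q: "q \<in> C"
      then have "u (c *\<^sub>R x) \<le> c * q x"
        using lb[OF q, of "c *\<^sub>R x"] sublinear_scaleR[of q c x] C c by simp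
      then show "u (c *\<^sub>R x) / c \<le> q x" using c by (simp add: field_simps)
    qed
    then show "u (c *\<^sub>R x) \<le> c * u x" using c by (simp add: field_simps)
  qed
  then show ?thesis using lb by blast
qed

text \<open>Minimality is tested against \<open>x \<mapsto> inf {m (x + t y) - t m y | t \<ge> 0}\<close>.\<close>

lemma sublinear_minimal_additive:
  fixes m :: "'a::real_vector \<Rightarrow> real"
  assumes m: "sublinear m" and min: "\<And>q. sublinear q \<Longrightarrow> (\<And>x. q x \<le> m x) \<Longrightarrow> q = m"
  shows "m (x + y) = m x + m y"
proof -
  define q where "q x = (INF t\<in>{0..}. m (x + t *\<^sub>R y) - t * m y)" for x
  have bd: "bdd_below ((\<lambda>t. m (x + t *\<^sub>R y) - t * m y) ` {0..})" for x
  proof (rule bdd_belowI2)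
    fix t :: real assume t: "t \<in> {0..}"
    have "m (t *\<^sub>R y) = t * m y" using t m by (cases "t = 0") (auto simp: sublinear_0 sublinear_scaleR)
    moreover have "m (t *\<^sub>R y) \<le> m (x + t *\<^sub>R y) + m (- x)"
      using sublinear_add[OF m, of "x + t *\<^sub>R y" "- x"] by simp
    ultimately show "- m (- x) \<le> m (x + t *\<^sub>R y) - t * m y" by simp
  qed
  have lb: "q x \<le> m (x + t *\<^sub>R y) - t * m y" if "t \<ge> 0" for t x
    unfolding q_def by (rule cINF_lower[OF bd]) (use that in simp)
  have "sublinear q"
  proof (rule sublinearI)
    fix a b
    have *: "q (a + b) \<le> (m (a + s *\<^sub>R y) - s * m y) + (m (b + t *\<^sub>R y) - t * m y)"
      if "s \<ge> 0" "t \<ge> 0" for s t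
    proof -
      have "q (a + b) \<le> m (a + b + (s + t) *\<^sub>R y) - (s + t) * m y" using that by (intro lb) simp
      also have "a + b + (s + t) *\<^sub>R y = (a + s *\<^sub>R y) + (b + t *\<^sub>R y)" by (simp add: algebra_simps)
      also have "m \<dots> \<le> m (a + s *\<^sub>R y) + m (b + t *\<^sub>R y)" by (rule sublinear_add[OF m])
      finally show ?thesis by (simp add: algebra_simps)
    qed
    have "q (a + b) - (m (a + s *\<^sub>R y) - s * m y) \<le> q b" if "s \<ge> 0" for s
      unfolding q_def[of b] by (rule cINF_greatest) (use *[OF that] in \<open>force+\<close>)
    then have "q (a + b) - q b \<le> q a"
      unfolding q_def[of a] by (intro cINF_greatest) force+
    then show "q (a + b) \<le> q a + q b" by simp
  next
    fix c :: real and x assume c: "c > 0"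
    have "q (c *\<^sub>R x) / c \<le> q x" unfolding q_def[of x]
    proof (rule cINF_greatest)
      fix t :: real assume t: "t \<in> {0..}"
      have "q (c *\<^sub>R x) \<le> m (c *\<^sub>R x + (c * t) *\<^sub>R y) - (c * t) * m y" using t c by (intro lb) simp
      also have "c *\<^sub>R x + (c * t) *\<^sub>R y = c *\<^sub>R (x + t *\<^sub>R y)" by (simp add: algebra_simps)
      also have "m \<dots> = c * m (x + t *\<^sub>R y)" by (rule sublinear_scaleR[OF m c])
      finally show "q (c *\<^sub>R x) / c \<le> m (x + t *\<^sub>R y) - t * m y" using c by (simp add: field_simps)
    qed simp
    then show "q (c *\<^sub>R x) \<le> c * q x" using c by (simp add: field_simps)
  qed
  then have "q = m" by (rule min) (use lb[of 0] in simp)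
  then have "m x \<le> m (x + y) - m y" using lb[of 1 x] by simp
  then show ?thesis using sublinear_add[OF m, of x y] by simp
qed

text \<open>No subspace is mentioned: where \<open>p\<close> is at most a given linear functional,
  the inequalities at \<open>x\<close> and \<open>- x\<close> force \<open>F\<close> to agree with
  it.\<close>

theorem sublinear_dominates_linear:
  fixes p :: "'a::real_vector \<Rightarrow> real"
  assumes p: "sublinear p"
  obtains F where "linear F" "\<And>x. F x \<le> p x"
proof -
  let ?A = "{q. sublinear q \<and> (\<forall>x. q x \<le> p x)}"
  \<comment> \<open>The order is reversed, so the maximal element given by Zorn is a minimal
    functional.\<close>
  let ?P = "\<lambda>q r::'a \<Rightarrow> real. \<forall>x. r x \<le> q x"
  have po: "partial_order_on ?A (relation_of ?P ?A)"
    by (rule partial_order_on_relation_ofI) (auto intro!: ext intro: order_trans order.antisym)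
  have "\<exists>m\<in>?A. \<forall>a\<in>?A. ?P m a \<longrightarrow> a = m"
  proof (rule predicate_Zorn[OF po])
    fix C assume C: "C \<in> Chains (relation_of ?P ?A)"
    then have CA: "C \<subseteq> ?A" by (auto simp: Chains_def relation_of_def)
    show "\<exists>u\<in>?A. \<forall>a\<in>C. ?P a u"
    proof (cases "C = {}")
      case True then show ?thesis using p by auto
    next
      case False
      have "\<exists>u. sublinear u \<and> (\<forall>q\<in>C. \<forall>x. u x \<le> q x)"
        by (rule sublinear_chain_lower_bound[OF False, where p=p])
           (use C CA in \<open>auto simp: Chains_def relation_of_def\<close>)
      then obtain u where u: "sublinear u" "\<And>q x. q \<in> C \<Longrightarrow> u x \<le> q x" by blast
      obtain q where "q \<in> C" using False by blast
      then have "u x \<le> p x" for x using u(2)[of q x] CA by (auto intro: order_trans)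
      then show ?thesis using u by auto
    qed
  qed
  then obtain m where m: "sublinear m" "\<And>x. m x \<le> p x"
    and min: "\<And>q. sublinear q \<Longrightarrow> (\<And>x. q x \<le> p x) \<Longrightarrow> (\<And>x. q x \<le> m x) \<Longrightarrow> q = m" by auto
  have add: "m (x + y) = m x + m y" for x y
    by (rule sublinear_minimal_additive[OF m(1)]) (metis min m(2) order_trans)
  have neg: "m (- x) = - m x" for x using add[of x "- x"] sublinear_0[OF m(1)] by simp
  have "linear m"
  proof (rule linearI)
    fix c :: real and x
    consider "c > 0" | "c = 0" | "- c > 0" by linarith
    then show "m (c *\<^sub>R x) = c *\<^sub>R m x"
    proof cases
      case 1 then show ?thesis by (simp add: sublinear_scaleR m)
    next
      case 2 then show ?thesis by (simp add: sublinear_0 m)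
    next
      case 3
      have "m (c *\<^sub>R x) = - m ((- c) *\<^sub>R x)" by (simp add: neg)
      also have "\<dots> = c * m x" unfolding sublinear_scaleR[OF m(1) 3] by simp
      finally show ?thesis by simp
    qed
  qed (rule add)
  then show thesis using that m by blast
qed

section \<open>The real unitization as a Banach algebra\<close>

datatype 'a unitization = Unitz (alg_part: 'a) (scal_part: real)

lemma unitz_eqI: "alg_part x = alg_part y \<Longrightarrow> scal_part x = scal_part y \<Longrightarrow> x = y"
  by (cases x; cases y) simp

instantiation unitization :: (real_vector) real_vector
begin

definition "(0 :: 'a unitization) = Unitz 0 0"
definition "x + (y :: 'a unitization) = Unitz (alg_part x + alg_part y) (scal_part x + scal_part y)"
definition "- (x :: 'a unitization) = Unitz (- alg_part x) (- scal_part x)"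
definition "x - (y :: 'a unitization) = Unitz (alg_part x - alg_part y) (scal_part x - scal_part y)"
definition "c *\<^sub>R (x :: 'a unitization) = Unitz (c *\<^sub>R alg_part x) (c * scal_part x)"

instance
  by standard
    (simp_all add: zero_unitization_def plus_unitization_def uminus_unitization_def
      minus_unitization_def scaleR_unitization_def algebra_simps)

end

instantiation unitization :: (real_normed_algebra) real_normed_algebra_1
begin

definition "(1 :: 'a unitization) = Unitz 0 1"
definition "x * (y :: 'a unitization) = Unitz (alg_part x * alg_part y + scal_part x *\<^sub>R alg_part y + scal_part y *\<^sub>R alg_part x)
  (scal_part x * scal_part y)"
definition "norm (x :: 'a unitization) = norm (alg_part x) + \<bar>scal_part x\<bar>"
definition "sgn (x :: 'a unitization) = x /\<^sub>R norm x"
definition "dist (x :: 'a unitization) y = norm (x - y)"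
definition "(uniformity :: ('a unitization \<times> 'a unitization) filter) = (INF e\<in>{0 <..}. principal {(x, y). dist x y < e})"
definition "open (U :: 'a unitization set) = (\<forall>x\<in>U. eventually (\<lambda>(x', y). x' = x \<longrightarrow> y \<in> U) uniformity)"

lemmas unitz_defs = zero_unitization_def one_unitization_def plus_unitization_def uminus_unitization_def
  minus_unitization_def scaleR_unitization_def times_unitization_def

instance
proof
  fix x y z :: "'a unitization" and a b c :: real
  show "norm (x * y) \<le> norm x * norm y"
  proof -
    have "norm (x * y) \<le> (norm (alg_part x) * norm (alg_part y) + \<bar>scal_part x\<bar> * norm (alg_part y)
       + \<bar>scal_part y\<bar> * norm (alg_part x)) + \<bar>scal_part x\<bar> * \<bar>scal_part y\<bar>"
      unfolding norm_unitization_def times_unitization_def unitization.sel abs_mult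
      by (intro add_right_mono norm_triangle_mono) (auto intro: norm_mult_ineq)
    then show ?thesis by (simp add: norm_unitization_def algebra_simps)
  qed
  show "norm (x + y) \<le> norm x + norm y"
    using norm_triangle_ineq[of "alg_part x" "alg_part y"] abs_triangle_ineq[of "scal_part x" "scal_part y"]
    by (simp add: norm_unitization_def plus_unitization_def)
  show "(norm x = 0) = (x = 0)"
    by (cases x) (auto simp: norm_unitization_def zero_unitization_def add_nonneg_eq_0_iff)
qed (simp_all add: unitz_defs norm_unitization_def sgn_unitization_def dist_unitization_def
    uniformity_unitization_def open_unitization_def algebra_simps abs_mult)

end

lemma unitz_sel [simp]:
  "alg_part 0 = 0" "scal_part 0 = 0" "alg_part 1 = 0" "scal_part 1 = 1"
  "alg_part (x + y) = alg_part x + alg_part y" "scal_part (x + y) = scal_part x + scal_part y"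
  "alg_part (- x) = - alg_part x" "scal_part (- x) = - scal_part x"
  "alg_part (x - y) = alg_part x - alg_part y" "scal_part (x - y) = scal_part x - scal_part y"
  "alg_part (c *\<^sub>R x) = c *\<^sub>R alg_part x" "scal_part (c *\<^sub>R x) = c * scal_part x"
  "alg_part (x * y) = alg_part x * alg_part y + scal_part x *\<^sub>R alg_part y + scal_part y *\<^sub>R alg_part x"
  "scal_part (x * y) = scal_part x * scal_part y"
  by (simp_all add: unitz_defs)

lemma norm_Unitz [simp]: "norm (Unitz a r) = norm a + \<bar>r\<bar>"
  by (simp add: norm_unitization_def)

instance unitization :: ("{real_normed_algebra,banach}") banach
proof
  fix X :: "nat \<Rightarrow> 'a unitization" assume X: "Cauchy X"
  have "Cauchy (\<lambda>n. alg_part (X n))" "Cauchy (\<lambda>n. scal_part (X n))"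
  proof -
    have le: "norm (alg_part (X m) - alg_part (X n)) \<le> norm (X m - X n)"
      "norm (scal_part (X m) - scal_part (X n)) \<le> norm (X m - X n)" for m n
      by (simp_all add: norm_unitization_def)
    show "Cauchy (\<lambda>n. alg_part (X n))" "Cauchy (\<lambda>n. scal_part (X n))"
      using X le unfolding Cauchy_iff by (meson le_less_trans)+
  qed
  then obtain a r where a: "(\<lambda>n. alg_part (X n)) \<longlonglongrightarrow> a" and r: "(\<lambda>n. scal_part (X n)) \<longlonglongrightarrow> r"
    by (meson Cauchy_convergent convergent_def)
  have "(\<lambda>n. norm (alg_part (X n) - a) + \<bar>scal_part (X n) - r\<bar>) \<longlonglongrightarrow> 0 + 0"
    using a r by (intro tendsto_add) (simp_all add: LIM_zero tendsto_norm_zero tendsto_rabs_zero)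
  then have "(\<lambda>n. norm (X n - Unitz a r)) \<longlonglongrightarrow> 0" by (simp add: norm_unitization_def)
  then have "X \<longlonglongrightarrow> Unitz a r" using LIM_zero_cancel tendsto_norm_zero_iff by blast
  then show "convergent X" by (auto simp: convergent_def)
qed

section \<open>Extension of states\<close>

lemma inv_el_Unitz:
  assumes "quasi_invertible a" shows "inv_el (Unitz (- a) 1)"
proof -
  obtain b where b: "a + b - a * b = 0" "a + b - b * a = 0"
    using assms unfolding quasi_invertible_def by blast
  have "Unitz (- a) 1 * Unitz (- b) 1 = 1" "Unitz (- b) 1 * Unitz (- a) 1 = 1"
    using b by (auto intro!: unitz_eqI simp: algebra_simps)
  then show ?thesis by (rule inv_elI)
qed

locale hermitian_banach_star =
  fixes cs :: "complex \<Rightarrow> 'a::{real_normed_algebra,banach} \<Rightarrow> 'a" and st :: "'a \<Rightarrow> 'a"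
  assumes bsa: "banach_star_alg cs st" and herm: "hermitian_alg cs st"
begin

lemma cs_of_real [simp]: "cs (complex_of_real r) x = r *\<^sub>R x"
  and cs_add_left: "cs (a + b) x = cs a x + cs b x"
  and cs_add: "cs a (x + y) = cs a x + cs a y"
  and cs_cs: "cs a (cs b x) = cs (a * b) x"
  and cs_mult_left: "cs a x * y = cs a (x * y)"
  and cs_mult_right: "x * cs a y = cs a (x * y)"
  and st_add: "st (x + y) = st x + st y"
  and st_cs: "st (cs a x) = cs (cnj a) (st x)"
  and st_mult: "st (x * y) = st y * st x"
  and st_st [simp]: "st (st x) = x"
  using bsa unfolding banach_star_alg_def by (blast | metis)+

lemma st_scaleR: "st (r *\<^sub>R x) = r *\<^sub>R st x"
  using st_cs[of "complex_of_real r" x] by simp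

lemma cs_scaleR: "cs c (r *\<^sub>R x) = r *\<^sub>R cs c x"
  using cs_cs[of c "complex_of_real r" x] cs_cs[of "complex_of_real r" c x] by (simp add: mult.commute)

lemma cs_1 [simp]: "cs 1 x = x" using cs_of_real[of 1 x] by simp
lemma cs_0 [simp]: "cs 0 x = 0" using cs_of_real[of 0 x] by simp
lemma cs_minus_left: "cs (- c) x = - cs c x"
  using cs_cs[of "- 1" c x] cs_of_real[of "- 1" "cs c x"] by simp
lemma cs_minus: "cs c (- x) = - cs c x" using cs_scaleR[of c "- 1" x] by simp
lemma cs_diff: "cs c (x - y) = cs c x - cs c y" using cs_add[of c x "- y"] by (simp add: cs_minus)
lemma st_minus: "st (- x) = - st x" using st_scaleR[of "- 1" x] by simp
lemma st_diff: "st (x - y) = st x - st y" using st_add[of x "- y"] by (simp add: st_minus)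
lemma st_0 [simp]: "st 0 = 0" using st_scaleR[of 0 0] by simp

lemma cs_Complex: "cs c x = Re c *\<^sub>R x + Im c *\<^sub>R cs \<i> x"
proof -
  have "c = complex_of_real (Re c) + complex_of_real (Im c) * \<i>" by (simp add: complex_eq mult.commute)
  then have "cs c x = cs (complex_of_real (Re c) + complex_of_real (Im c) * \<i>) x" by simp
  then show ?thesis by (simp only: cs_add_left cs_of_real cs_cs[symmetric])
qed

definition ust :: "'a unitization \<Rightarrow> 'a unitization" where
  "ust x = Unitz (st (alg_part x)) (scal_part x)"

lemma inv_el_nonreal:
  assumes "st h = h" "z \<notin> \<real>" shows "inv_el (Unitz (- cs z h) 1)"
proof (rule inv_el_Unitz)
  have "inverse z \<notin> \<real>" using assms(2) by (metis Reals_inverse inverse_inverse_eq)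
  moreover have "alg_spectrum cs h \<subseteq> \<real>" using herm assms(1) unfolding hermitian_alg_def by blast
  ultimately have "inverse z \<notin> alg_spectrum cs h" "inverse z \<noteq> 0" by auto
  then show "quasi_invertible (cs z h)" unfolding alg_spectrum_def by auto
qed

sublocale U: hermitian_star_algebra ust
proof
  fix x y h k :: "'a unitization" and c :: real
  show "ust (x + y) = ust x + ust y" by (auto intro!: unitz_eqI simp: ust_def st_add)
  show "ust (c *\<^sub>R x) = c *\<^sub>R ust x" by (auto intro!: unitz_eqI simp: ust_def st_scaleR)
  show "ust (x * y) = ust y * ust x" by (auto intro!: unitz_eqI simp: ust_def st_add st_mult st_scaleR)
  show "ust (ust x) = x" by (auto intro!: unitz_eqI simp: ust_def)
  show "inv_el (1 + h * h)" if "ust h = h"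
  proof -
    define a l where "a = alg_part h" and "l = scal_part h"
    have a: "st a = a" using that by (cases h) (simp add: ust_def a_def)
    define c where "c = 1 + l\<^sup>2"
    have c: "c > 0" by (simp add: c_def add_pos_nonneg)
    \<comment> \<open>\<open>z = -1 / (l + \<i>)\<close>, from \<open>1 + (a + l)^2 = (l + \<i>) (l
      - \<i>) (1 - z a) (1 - cnj z a)\<close>. Both last factors lie in the real unitization because
      complex scalars act on \<open>a\<close>.\<close>
    define z where "z = Complex (- l / c) (1 / c)"
    have "z \<notin> \<real>" "cnj z \<notin> \<real>" using c by (auto simp: z_def complex_is_Real_iff)
    then have i: "inv_el (c *\<^sub>R (Unitz (- cs z a) 1 * Unitz (- cs (cnj z) a) 1))"
      using c a by (intro inv_el_scaleR inv_el_mult inv_el_nonreal) auto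
    have zz: "z * cnj z = complex_of_real (1 / c)"
      using c by (simp add: complex_mult_cnj z_def power_divide add_divide_distrib[symmetric])
        (simp add: c_def power2_eq_square divide_simps)
    have "cs z a + cs (cnj z) a = (- 2 * l / c) *\<^sub>R a"
      unfolding cs_add_left[symmetric] complex_add_cnj by (simp only: cs_of_real) (simp add: z_def)
    then have "cs z a * cs (cnj z) a - cs z a - cs (cnj z) a = (1 / c) *\<^sub>R (a * a) + (2 * l / c) *\<^sub>R a"
      by (simp add: cs_mult_left cs_mult_right cs_cs zz[unfolded of_real_divide] mult.commute diff_diff_eq)
        (metis cs_of_real of_real_1 of_real_divide)
    then have "Unitz (- cs z a) 1 * Unitz (- cs (cnj z) a) 1 = Unitz ((1 / c) *\<^sub>R (a * a) + (2 * l / c) *\<^sub>R a) 1"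
      by (intro unitz_eqI) (simp_all add: algebra_simps)
    moreover have "c *\<^sub>R Unitz ((1 / c) *\<^sub>R (a * a) + (2 * l / c) *\<^sub>R a) 1 = 1 + h * h"
    proof (rule unitz_eqI)
      show "alg_part (c *\<^sub>R Unitz ((1 / c) *\<^sub>R (a * a) + (2 * l / c) *\<^sub>R a) 1) = alg_part (1 + h * h)"
      proof -
        have "l *\<^sub>R a + l *\<^sub>R a = (2 * l) *\<^sub>R a" by (simp flip: scaleR_add_left)
        then show ?thesis using c by (simp add: a_def[symmetric] l_def[symmetric] scaleR_add_right add.assoc)
      qed
    qed (simp add: c_def l_def power2_eq_square)
    ultimately have "c *\<^sub>R (Unitz (- cs z a) 1 * Unitz (- cs (cnj z) a) 1) = 1 + h * h" by simp
    then show ?thesis using i by simp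
  qed
  show "inv_el (1 + k)" if "ust k = - k"
  proof -
    have s: "scal_part k = 0" "st (alg_part k) = - alg_part k"
      using arg_cong[OF that, of scal_part] arg_cong[OF that, of alg_part] by (auto simp: ust_def)
    define h where "h = cs \<i> (alg_part k)"
    have "st h = h" by (simp add: h_def st_cs s cs_minus_left cs_minus)
    then have "inv_el (Unitz (- cs \<i> h) 1)" by (rule inv_el_nonreal) (simp add: complex_is_Real_iff)
    also have "Unitz (- cs \<i> h) 1 = 1 + k"
      by (rule unitz_eqI) (simp_all add: h_def cs_cs s cs_minus_left)
    finally show ?thesis .
  qed
qed

end

section \<open>Elementary inequalities\<close>

lemma quadratic_form_bound:
  fixes C :: complex
  assumes "\<And>z. 0 \<le> A + 2 * Re (z * C) + (cmod z)\<^sup>2 * B" shows "(cmod C)\<^sup>2 \<le> A * B"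
proof -
  \<comment> \<open>Turning \<open>z\<close> against \<open>C\<close> leaves a real parameter
    \<open>t\<close>. The sign of \<open>B\<close> is open; for \<open>B \<le> 0\<close> a large
    argument contradicts the hypothesis unless the claim holds.\<close>
  have *: "0 \<le> A - 2 * t * (cmod C)\<^sup>2 + t\<^sup>2 * (cmod C)\<^sup>2 * B" for t :: real
  proof -
    have "Re (- (complex_of_real t * cnj C) * C) = - t * (cmod C)\<^sup>2"
      unfolding cmod_power2 by (simp add: power2_eq_square algebra_simps)
    moreover have "(cmod (- (complex_of_real t * cnj C)))\<^sup>2 = t\<^sup>2 * (cmod C)\<^sup>2"
      by (simp add: norm_mult power_mult_distrib)
    ultimately show ?thesis using assms[of "- (complex_of_real t * cnj C)"] by simp
  qed
  show ?thesis
  proof (cases "B > 0")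
    case True
    then show ?thesis using *[of "1 / B"] by (simp add: field_simps power2_eq_square)
  next
    case False
    have A: "A \<ge> 0" using assms[of 0] by simp
    show ?thesis
    proof (rule ccontr)
      assume n: "\<not> ?thesis"
      have C: "(cmod C)\<^sup>2 > 0"
      proof (rule ccontr)
        assume "\<not> (cmod C)\<^sup>2 > 0"
        then have C0: "C = 0" by simp
        then have "A * B < 0" using n by simp
        then have AB: "A > 0" "B < 0" using A by (auto simp: mult_less_0_iff)
        have "0 \<le> A + (cmod (complex_of_real (sqrt ((A + 1) / - B))))\<^sup>2 * B"
          using assms[of "complex_of_real (sqrt ((A + 1) / - B))"] C0 by simp
        also have "(cmod (complex_of_real (sqrt ((A + 1) / - B))))\<^sup>2 = (A + 1) / - B"
          using AB by (simp add: divide_nonneg_neg)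
        finally show False using AB by simp
      qed
      define t where "t = (A + 1) / (cmod C)\<^sup>2"
      have "t * (cmod C)\<^sup>2 = A + 1" using C by (simp add: t_def)
      moreover have "t\<^sup>2 * (cmod C)\<^sup>2 * B \<le> 0" using False by (simp add: mult_nonneg_nonpos)
      ultimately show False using *[of t] A by (simp add: mult.assoc)
    qed
  qed
qed

lemma le_if_power_le:
  fixes a c K :: real
  assumes "0 \<le> a" "0 \<le> c" "\<And>n. a ^ (2 ^ n) \<le> K * c ^ (2 ^ n)" shows "a \<le> c"
proof (rule ccontr)
  assume "\<not> a \<le> c"
  then have ac: "a > c" by simp
  have "c \<noteq> 0" using assms(3)[of 0] ac by auto
  then have c: "c > 0" using assms(2) by simp
  obtain n where n: "K < (a / c) ^ n" using real_arch_pow[of "a / c" K] ac c by auto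
  also have "(a / c) ^ n \<le> (a / c) ^ (2 ^ n)"
    using ac c by (intro power_increasing less_imp_le[OF less_exp]) auto
  finally have "K * c ^ (2 ^ n) < a ^ (2 ^ n)" using c by (simp add: power_divide field_simps)
  then show False using assms(3)[of n] by simp
qed

section \<open>The given state on the subalgebra\<close>

locale hermitian_star_state = hermitian_banach_star cs st
  for cs :: "complex \<Rightarrow> 'a::{real_normed_algebra,banach} \<Rightarrow> 'a" and st +
  fixes D :: "'a set" and \<phi> :: "'a \<Rightarrow> complex"
  assumes sub: "star_subalg cs st D" and state: "state_on cs st D \<phi>"
begin

lemma D_0: "0 \<in> D" and D_add: "x \<in> D \<Longrightarrow> y \<in> D \<Longrightarrow> x + y \<in> D"
  and D_mult: "x \<in> D \<Longrightarrow> y \<in> D \<Longrightarrow> x * y \<in> D" and D_cs: "x \<in> D \<Longrightarrow> cs c x \<in> D"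
  and D_st: "x \<in> D \<Longrightarrow> st x \<in> D"
  using sub unfolding star_subalg_def by blast+

lemma D_scaleR: "x \<in> D \<Longrightarrow> r *\<^sub>R x \<in> D" using D_cs[of x "complex_of_real r"] by simp
lemma D_minus: "x \<in> D \<Longrightarrow> - x \<in> D" using D_scaleR[of x "- 1"] by simp
lemma D_diff: "x \<in> D \<Longrightarrow> y \<in> D \<Longrightarrow> x - y \<in> D" using D_add[of x "- y"] D_minus by simp

lemmas D_closed = D_0 D_add D_mult D_cs D_st D_scaleR D_minus D_diff

lemma \<phi>_add: "x \<in> D \<Longrightarrow> y \<in> D \<Longrightarrow> \<phi> (x + y) = \<phi> x + \<phi> y"
  and \<phi>_cs: "x \<in> D \<Longrightarrow> \<phi> (cs c x) = c * \<phi> x"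
  using state unfolding state_on_def lin_fun_on_def by blast+

lemma \<phi>_scaleR: "x \<in> D \<Longrightarrow> \<phi> (r *\<^sub>R x) = r * \<phi> x" using \<phi>_cs[of x "complex_of_real r"] by simp
lemma \<phi>_minus: "x \<in> D \<Longrightarrow> \<phi> (- x) = - \<phi> x" using \<phi>_scaleR[of x "- 1"] by simp
lemma \<phi>_diff: "x \<in> D \<Longrightarrow> y \<in> D \<Longrightarrow> \<phi> (x - y) = \<phi> x - \<phi> y"
  using \<phi>_add[of x "- y"] D_minus \<phi>_minus by simp
lemma \<phi>_0: "\<phi> 0 = 0" using \<phi>_scaleR[OF D_0, of 0] by simp

lemma \<phi>_pos: "b \<in> D \<Longrightarrow> Im (\<phi> (st b * b)) = 0" "b \<in> D \<Longrightarrow> Re (\<phi> (st b * b)) \<ge> 0"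
  using state unfolding state_on_def positive_on_def by blast+

text \<open>The square of the GNS seminorm.\<close>

definition sqn :: "'a \<Rightarrow> real" where "sqn b = Re (\<phi> (st b * b))"

lemma sqn_nonneg: "b \<in> D \<Longrightarrow> sqn b \<ge> 0" unfolding sqn_def by (rule \<phi>_pos)
lemma \<phi>_sqn: "b \<in> D \<Longrightarrow> \<phi> (st b * b) = complex_of_real (sqn b)"
  unfolding sqn_def by (simp add: complex_eq_iff \<phi>_pos)


lemma var_bound_Inf: "Inf {\<gamma>. var_bound st D \<phi> \<gamma>} = 1" "{\<gamma>. var_bound st D \<phi> \<gamma>} \<noteq> {}"
  "bdd_below {\<gamma>. var_bound st D \<phi> \<gamma>}"
  using state by (auto simp: state_on_def variation_def finite_variation_def var_bound_def intro: bdd_belowI[of _ 0])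

lemma cmod_\<phi>_sq_le: assumes b: "b \<in> D" shows "(cmod (\<phi> b))\<^sup>2 \<le> sqn b"
proof (rule field_le_epsilon)
  fix e :: real assume e: "e > 0"
  define d where "d = e / (sqn b + 1)"
  have s: "sqn b + 1 > 0" using sqn_nonneg[OF b] by simp
  then have "d > 0" using e by (simp add: d_def)
  then obtain g where g: "var_bound st D \<phi> g" "g < 1 + d"
    using cInf_lessD[OF var_bound_Inf(2), of "1 + d"] var_bound_Inf(1) by auto
  have "(cmod (\<phi> b))\<^sup>2 \<le> g * sqn b" using g(1) b by (auto simp: var_bound_def sqn_def)
  also have "\<dots> \<le> (1 + d) * sqn b" using g(2) sqn_nonneg[OF b] by (intro mult_right_mono) auto
  also have "\<dots> \<le> sqn b + d * (sqn b + 1)" using \<open>d > 0\<close> by (simp add: algebra_simps)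
  also have "\<dots> = sqn b + e" using s by (simp add: d_def)
  finally show "(cmod (\<phi> b))\<^sup>2 \<le> sqn b + e" .
qed

lemma var_bound_ge_1: "var_bound st D \<phi> \<gamma> \<Longrightarrow> 1 \<le> \<gamma>"
  using cInf_lower[OF _ var_bound_Inf(3), of \<gamma>] var_bound_Inf(1) by simp

text \<open>Some \<open>a\<close> nearly attains the variation; scaling it by
  \<open>cnj (\<phi> a) / sqn a\<close> equalizes \<open>\<phi>\<close> and \<open>sqn\<close>, so
  the squared distance to the unit, \<open>sqn b - 2 \<phi> b + 1\<close>, is
  \<open>1 - r\<close>.\<close>

lemma approx_unit_vector:
  assumes e: "0 < e" "e < 1"
  obtains b r where "b \<in> D" "\<phi> b = complex_of_real r" "sqn b = r" "1 - e < r" "r \<le> 1"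
proof -
  have "\<not> var_bound st D \<phi> (1 - e)" using var_bound_ge_1[of "1 - e"] e by auto
  then obtain a where a: "a \<in> D" "(cmod (\<phi> a))\<^sup>2 > (1 - e) * sqn a"
    using e by (auto simp: var_bound_def sqn_def not_le)
  define s where "s = sqn a"
  have "(cmod (\<phi> a))\<^sup>2 \<le> s" unfolding s_def by (rule cmod_\<phi>_sq_le[OF a(1)])
  moreover have "(1 - e) * s \<ge> 0" using e sqn_nonneg[OF a(1)] by (simp add: s_def)
  ultimately have s: "s > 0" using a(2)[folded s_def] by linarith
  define r where "r = (cmod (\<phi> a))\<^sup>2 / s"
  define c where "c = cnj (\<phi> a) / s"
  have "\<phi> (cs c a) = complex_of_real r"
    using a(1) by (simp add: \<phi>_cs c_def r_def mult.commute[of "cnj (\<phi> a)"] complex_norm_square del: of_real_power)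
  moreover have "sqn (cs c a) = r"
  proof -
    have "\<phi> (st (cs c a) * cs c a) = (cnj c * c) * \<phi> (st a * a)"
      using a(1) by (simp add: st_cs cs_mult_left cs_mult_right cs_cs \<phi>_cs D_closed mult_ac)
    also have "cnj c * c = complex_of_real ((cmod (\<phi> a))\<^sup>2 / s\<^sup>2)"
      using complex_norm_square[of c] by (simp add: mult.commute c_def norm_divide power_divide)
    finally show ?thesis using s a(1) by (simp add: sqn_def[of "cs c a"] \<phi>_sqn s_def[symmetric] r_def power2_eq_square)
  qed
  moreover have "1 - e < r" "r \<le> 1" using a(2) cmod_\<phi>_sq_le[OF a(1)] s by (simp_all add: r_def s_def field_simps)
  ultimately show thesis using that D_cs[OF a(1)] by blast
qed

lemma \<phi>_expand:
  assumes "a \<in> D" "b \<in> D"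
  shows "\<phi> (st (a + cs z b) * (a + cs z b)) =
    \<phi> (st a * a) + z * \<phi> (st a * b) + cnj z * \<phi> (st b * a) + (cnj z * z) * \<phi> (st b * b)"
proof -
  have "st (a + cs z b) * (a + cs z b)
    = st a * a + cs z (st a * b) + cs (cnj z) (st b * a) + cs (cnj z * z) (st b * b)"
    by (simp add: st_add st_cs distrib_left distrib_right cs_mult_left cs_mult_right cs_cs cs_add mult.commute add.assoc)
  then show ?thesis using assms by (simp add: \<phi>_add \<phi>_cs D_closed)
qed

text \<open>Polarization: the values at \<open>a + b\<close> and \<open>a + \<i> b\<close> are
  real.\<close>

lemma \<phi>_sym:
  assumes "a \<in> D" "b \<in> D" shows "\<phi> (st b * a) = cnj (\<phi> (st a * b))"
proof -
  have "Im (\<phi> (st a * b) + \<phi> (st b * a)) = 0"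
    using \<phi>_expand[OF assms, of 1] \<phi>_pos(1)[of "a + cs 1 b"] assms by (simp add: \<phi>_pos D_closed)
  moreover have "Im (\<i> * \<phi> (st a * b) - \<i> * \<phi> (st b * a)) = 0"
    using \<phi>_expand[OF assms, of \<i>] \<phi>_pos(1)[of "a + cs \<i> b"] assms by (simp add: \<phi>_pos D_closed)
  ultimately show ?thesis by (simp add: complex_eq_iff)
qed

lemma sqn_expand:
  assumes "a \<in> D" "b \<in> D"
  shows "sqn (a + cs z b) = sqn a + 2 * Re (z * \<phi> (st a * b)) + (cmod z)\<^sup>2 * sqn b"
proof -
  have "cnj z * z = complex_of_real ((cmod z)\<^sup>2)" using complex_norm_square[of z] by (simp add: mult.commute)
  then show ?thesis
    using \<phi>_expand[OF assms, of z] assms unfolding sqn_def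
    by (simp add: \<phi>_sym[OF assms])
qed

lemma \<phi>_Cauchy_Schwarz:
  assumes "a \<in> D" "b \<in> D" shows "(cmod (\<phi> (st a * b)))\<^sup>2 \<le> sqn a * sqn b"
proof (rule quadratic_form_bound)
  fix z show "0 \<le> sqn a + 2 * Re (z * \<phi> (st a * b)) + (cmod z)\<^sup>2 * sqn b"
    using sqn_nonneg[of "a + cs z b"] assms by (simp add: sqn_expand D_closed)
qed

text \<open>
  Cauchy--Schwarz for the form on \<open>D \<oplus> \<complex>\<close> which is semidefinite because \<open>\<phi>\<close> has variation 1:
  \<open>b\<close> is close to the vector that represents \<open>\<phi>\<close>.
\<close>

lemma \<phi>_near:
  assumes d: "d \<in> D" and b: "b \<in> D" "\<phi> b = complex_of_real r" "sqn b = r"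
  shows "(cmod (\<phi> (st d * b) - cnj (\<phi> d)))\<^sup>2 \<le> sqn d * (1 - r)"
proof (rule quadratic_form_bound)
  fix z
  have le: "- (2 * Re (cnj z * x)) - (cmod z)\<^sup>2 \<le> (cmod x)\<^sup>2" for x
  proof -
    have "0 \<le> (cmod (x + z))\<^sup>2" by simp
    also have "\<dots> = (cmod x)\<^sup>2 + 2 * Re (cnj z * x) + (cmod z)\<^sup>2"
      unfolding cmod_power2 by (simp add: power2_eq_square algebra_simps)
    finally show ?thesis by simp
  qed
  \<comment> \<open>Positivity of the form at \<open>d + z (b - 1)\<close>, where
    \<open>b - 1\<close> has squared length \<open>1 - r\<close>.\<close>
  have "0 \<le> sqn (d + cs z b) - 2 * Re (cnj z * \<phi> (d + cs z b)) + (cmod z)\<^sup>2"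
    using le[of "- \<phi> (d + cs z b)"] cmod_\<phi>_sq_le[of "d + cs z b"] d b by (simp add: D_closed)
  also have "\<phi> (d + cs z b) = \<phi> d + z * complex_of_real r" using d b by (simp add: \<phi>_add \<phi>_cs D_closed)
  also have "Re (cnj z * (\<phi> d + z * complex_of_real r)) = Re (z * cnj (\<phi> d)) + (cmod z)\<^sup>2 * r"
    unfolding cmod_power2 by (simp add: power2_eq_square algebra_simps)
  finally show "0 \<le> sqn d + 2 * Re (z * (\<phi> (st d * b) - cnj (\<phi> d))) + (cmod z)\<^sup>2 * (1 - r)"
    using d b by (simp add: sqn_expand algebra_simps)
qed

lemma weakly_bounded:
  assumes "c \<in> D" obtains K where "\<And>b. b \<in> D \<Longrightarrow> st b = b \<Longrightarrow> cmod (\<phi> (st c * b * c)) \<le> K * norm b"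
proof -
  have "continuous_on {b\<in>D. st b = b} (\<lambda>b. \<phi> (st c * b * c))"
    using state assms unfolding state_on_def weakly_cont_sa_def by blast
  then obtain e where e: "e > 0" and
    ee: "\<And>b. b \<in> D \<Longrightarrow> st b = b \<Longrightarrow> dist b 0 < e \<Longrightarrow> dist (\<phi> (st c * b * c)) (\<phi> (st c * 0 * c)) < 1"
    unfolding continuous_on_iff using D_0 by (force dest: bspec[of _ _ 0] spec[of _ 1])
  have "cmod (\<phi> (st c * b * c)) \<le> (2 / e) * norm b" if b: "b \<in> D" "st b = b" for b
  proof (cases "b = 0")
    case True then show ?thesis by (simp add: \<phi>_0)
  next
    case False
    define r where "r = e / (2 * norm b)"
    have r: "r > 0" using False e by (simp add: r_def)
    have "norm (r *\<^sub>R b) < e" using False e by (simp add: r_def)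
    then have "cmod (\<phi> (st c * (r *\<^sub>R b) * c)) < 1"
      using ee[of "r *\<^sub>R b"] b by (simp add: D_closed st_scaleR \<phi>_0)
    then have "r * cmod (\<phi> (st c * b * c)) < 1"
      using r b assms by (simp add: \<phi>_scaleR D_closed norm_mult)
    then show ?thesis using False e by (simp add: r_def field_simps)
  qed
  then show thesis using that by blast
qed

text \<open>Represents \<open>d ^ (2 ^ n)\<close> in an algebra that need not have a unit.\<close>

primrec iterated_square :: "nat \<Rightarrow> 'a \<Rightarrow> 'a" where
  "iterated_square 0 d = d" | "iterated_square (Suc n) d = iterated_square n d * iterated_square n d"

lemma iterated_square: assumes "d \<in> D" "st d = d"
  shows "iterated_square n d \<in> D" "st (iterated_square n d) = iterated_square n d" "norm (iterated_square n d) \<le> norm d ^ (2 ^ n)"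
proof (induction n)
  case (Suc n)
  { case 1 show ?case using Suc by (simp add: D_closed) }
  { case 2 show ?case using Suc by (simp add: st_mult) }
  { case 3
    have "norm (iterated_square (Suc n) d) \<le> norm (iterated_square n d) * norm (iterated_square n d)" by (simp add: norm_mult_ineq)
    also have "\<dots> \<le> norm d ^ (2 ^ n) * norm d ^ (2 ^ n)" using Suc by (intro mult_mono) auto
    finally show ?case by (simp add: power_add[symmetric] mult_2) }
qed (use assms in auto)

text \<open>Iterated Cauchy--Schwarz pushes the constant \<open>K\<close> of weak continuity into
  the \<open>2 ^ n\<close>-th power, where taking roots removes it.\<close>

lemma \<phi>_sandwich_bound:
  assumes b: "b \<in> D" and d: "d \<in> D" "st d = d"
  shows "cmod (\<phi> (st b * d * b)) \<le> sqn b * norm d"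
proof -
  define s where "s = sqn b"
  define m where "m n = cmod (\<phi> (st b * iterated_square n d * b))" for n
  have s0: "s \<ge> 0" unfolding s_def by (rule sqn_nonneg[OF b])
  have m0: "m n \<ge> 0" for n by (simp add: m_def)
  have step: "(m n)\<^sup>2 \<le> s * m (Suc n)" for n
  proof -
    let ?e = "iterated_square n d"
    have e: "?e \<in> D" "st ?e = ?e" using iterated_square d by auto
    have "(m n)\<^sup>2 \<le> s * sqn (?e * b)"
      using \<phi>_Cauchy_Schwarz[of b "?e * b"] b e by (simp add: m_def s_def D_closed mult.assoc)
    also have "sqn (?e * b) \<le> m (Suc n)"
      using complex_Re_le_cmod[of "\<phi> (st b * (?e * (?e * b)))"] e(2) by (simp add: sqn_def m_def st_mult mult.assoc)
    then have "s * sqn (?e * b) \<le> s * m (Suc n)" using s0 by (rule mult_left_mono)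
    finally show ?thesis .
  qed
  obtain K where K: "\<And>b'. b' \<in> D \<Longrightarrow> st b' = b' \<Longrightarrow> cmod (\<phi> (st b * b' * b)) \<le> K * norm b'"
    using weakly_bounded[OF b] by blast
  show ?thesis
  proof (cases "s = 0")
    case True
    then show ?thesis using step[of 0] by (simp add: m_def s_def)
  next
    case False
    then have s: "s > 0" using s0 by simp
    \<comment> \<open>The extra factor \<open>s\<close> on the left avoids the exponent
      \<open>2 ^ n - 1\<close>.\<close>
    have P: "s * m 0 ^ (2 ^ n) \<le> s ^ (2 ^ n) * m n" for n
    proof (induction n)
      case (Suc n)
      have p: "x ^ (2 ^ Suc n) = (x ^ (2 ^ n))\<^sup>2" for x :: real by (simp add: power_mult[symmetric] mult.commute)
      have "s * (s * m 0 ^ (2 ^ Suc n)) = (s * m 0 ^ (2 ^ n))\<^sup>2" unfolding p by (simp add: power2_eq_square)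
      also have "\<dots> \<le> (s ^ (2 ^ n) * m n)\<^sup>2" using Suc s m0 by (intro power_mono) auto
      also have "\<dots> = s ^ (2 ^ Suc n) * (m n)\<^sup>2" unfolding p by (simp add: power_mult_distrib)
      also have "\<dots> \<le> s ^ (2 ^ Suc n) * (s * m (Suc n))" using s by (intro mult_left_mono step) auto
      also have "\<dots> = s * (s ^ (2 ^ Suc n) * m (Suc n))" by simp
      finally show ?case using s by (simp del: power_Suc)
    qed simp
    have "m 0 \<le> s * norm d"
    proof (rule le_if_power_le)
      fix n
      have "m n \<le> K * norm (iterated_square n d)" unfolding m_def by (rule K) (use iterated_square d in auto)
      also have "\<dots> \<le> \<bar>K\<bar> * norm d ^ (2 ^ n)" using iterated_square(3)[OF d, of n] by (intro mult_mono) auto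
      finally have "s ^ (2 ^ n) * m n \<le> s ^ (2 ^ n) * (\<bar>K\<bar> * norm d ^ (2 ^ n))" using s by (intro mult_left_mono) auto
      then have "s * m 0 ^ (2 ^ n) \<le> \<bar>K\<bar> * (s * norm d) ^ (2 ^ n)" using P[of n] by (simp add: power_mult_distrib mult_ac)
      then show "m 0 ^ (2 ^ n) \<le> (\<bar>K\<bar> / s) * (s * norm d) ^ (2 ^ n)" using s by (simp add: field_simps)
    qed (use s m0 in auto)
    then show ?thesis by (simp add: m_def s_def)
  qed
qed

text \<open>Two uses of \<open>\<phi>_near\<close>: \<open>\<phi> d\<close> is close to
  \<open>cnj (\<phi> (d * b))\<close>, which is close to the real number
  \<open>\<phi> (st b * d * b)\<close>. Each squared error carries \<open>1 - r\<close>, hence the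
  choice of \<open>e\<^sup>2\<close>.\<close>

lemma \<phi>_approx_real:
  assumes d: "d \<in> D" "st d = d" and e: "0 < e" "e < 1"
  shows "\<exists>r::real. \<bar>r\<bar> \<le> norm d \<and> cmod (\<phi> d - complex_of_real r) \<le> e * (sqrt (norm (d * d)) + sqrt (sqn d))"
proof -
  have "0 < e\<^sup>2" "e\<^sup>2 < 1" using e by (auto simp: power_less_one_iff abs_square_less_1)
  then obtain b r where b: "b \<in> D" "\<phi> b = complex_of_real r" "sqn b = r" and r: "1 - e\<^sup>2 < r" "r \<le> 1"
    by (rule approx_unit_vector)
  have r0: "r \<ge> 0" using r \<open>e\<^sup>2 < 1\<close> by simp
  let ?x = "\<phi> (st b * d * b)"
  have "cnj ?x = ?x" using \<phi>_sym[of b "d * b"] b d by (simp add: D_closed st_mult mult.assoc)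
  then have x: "?x = complex_of_real (Re ?x)" by (simp add: complex_eq_iff)
  have xb: "cmod ?x \<le> norm d"
    using \<phi>_sandwich_bound[OF b(1) d] b(3) r mult_right_mono[of r 1 "norm d"] by simp
  have 1: "cmod (\<phi> (d * b) - cnj (\<phi> d)) \<le> e * sqrt (sqn d)"
  proof -
    have "(cmod (\<phi> (d * b) - cnj (\<phi> d)))\<^sup>2 \<le> sqn d * (1 - r)" using \<phi>_near[OF d(1) b] d(2) by simp
    also have "\<dots> \<le> sqn d * e\<^sup>2" using r sqn_nonneg[OF d(1)] by (intro mult_left_mono) auto
    also have "\<dots> = (e * sqrt (sqn d))\<^sup>2" using sqn_nonneg[OF d(1)] by (simp add: power_mult_distrib)
    finally show ?thesis by (rule power2_le_imp_le) (use e sqn_nonneg[OF d(1)] in simp)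
  qed
  have 2: "cmod (?x - cnj (\<phi> (d * b))) \<le> e * sqrt (norm (d * d))"
  proof -
    have db: "d * b \<in> D" using b d by (simp add: D_closed)
    have "(cmod (?x - cnj (\<phi> (d * b))))\<^sup>2 \<le> sqn (d * b) * (1 - r)"
      using \<phi>_near[OF db b] d(2) by (simp add: st_mult)
    also have "\<dots> \<le> sqn (d * b) * e\<^sup>2" using r sqn_nonneg[OF db] by (intro mult_left_mono) auto
    also have "sqn (d * b) \<le> norm (d * d)"
    proof -
      have "sqn (d * b) \<le> cmod (\<phi> (st b * (d * d) * b))"
        using complex_Re_le_cmod[of "\<phi> (st b * (d * d) * b)"] d(2) by (simp add: sqn_def st_mult mult.assoc)
      also have "\<dots> \<le> sqn b * norm (d * d)" by (rule \<phi>_sandwich_bound) (use b d in \<open>auto simp: D_closed st_mult\<close>)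
      also have "\<dots> \<le> 1 * norm (d * d)" using b r by (intro mult_right_mono) auto
      finally show ?thesis by simp
    qed
    then have "sqn (d * b) * e\<^sup>2 \<le> norm (d * d) * e\<^sup>2" by (intro mult_right_mono) auto
    also have "\<dots> = (e * sqrt (norm (d * d)))\<^sup>2" by (simp add: power_mult_distrib)
    finally show ?thesis by (rule power2_le_imp_le) (use e in simp)
  qed
  have "cmod (\<phi> d - ?x) = cmod (cnj (cnj (\<phi> d) - \<phi> (d * b)) - (?x - cnj (\<phi> (d * b))))"
    by (simp add: algebra_simps)
  also have "\<dots> \<le> cmod (cnj (\<phi> d) - \<phi> (d * b)) + cmod (?x - cnj (\<phi> (d * b)))"
    using norm_triangle_ineq4[of "cnj (cnj (\<phi> d) - \<phi> (d * b))"] unfolding complex_mod_cnj .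
  also have "\<dots> \<le> e * sqrt (sqn d) + e * sqrt (norm (d * d))"
    using 1 2 by (simp add: norm_minus_commute)
  finally have "cmod (\<phi> d - complex_of_real (Re ?x)) \<le> e * (sqrt (norm (d * d)) + sqrt (sqn d))"
    using x by (simp add: algebra_simps)
  moreover have "\<bar>Re ?x\<bar> \<le> norm d" using xb abs_Re_le_cmod[of ?x] by linarith
  ultimately show ?thesis by blast
qed

lemma \<phi>_herm:
  assumes d: "d \<in> D" "st d = d"
  shows "Im (\<phi> d) = 0" "cmod (\<phi> d) \<le> norm d"
proof -
  define M where "M = sqrt (norm (d * d)) + sqrt (sqn d) + 1"
  have M: "M > 0" using sqn_nonneg[OF d(1)] by (simp add: M_def add_nonneg_pos)
  have key: "\<bar>Im (\<phi> d)\<bar> \<le> 0 + \<delta> \<and> cmod (\<phi> d) \<le> norm d + \<delta>" if \<delta>: "\<delta> > 0" for \<delta>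
  proof -
    define e where "e = min (1/2) (\<delta> / M)"
    have e: "0 < e" "e < 1" using \<delta> M by (auto simp: e_def)
    obtain r :: real where r: "\<bar>r\<bar> \<le> norm d" "cmod (\<phi> d - complex_of_real r) \<le> e * (sqrt (norm (d * d)) + sqrt (sqn d))"
      using \<phi>_approx_real[OF d e] by blast
    have "e * (sqrt (norm (d * d)) + sqrt (sqn d)) \<le> (\<delta> / M) * M"
      using e M sqn_nonneg[OF d(1)] \<delta> by (intro mult_mono) (auto simp: e_def M_def)
    then have c: "cmod (\<phi> d - complex_of_real r) \<le> \<delta>" using r(2) M by simp
    then have "\<bar>Im (\<phi> d)\<bar> \<le> \<delta>" using abs_Im_le_cmod[of "\<phi> d - complex_of_real r"] by simp
    moreover have "cmod (\<phi> d) \<le> cmod (complex_of_real r) + \<delta>"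
      using c norm_triangle_sub[of "\<phi> d" "complex_of_real r"] by simp
    ultimately show ?thesis using r(1) by simp
  qed
  have "\<bar>Im (\<phi> d)\<bar> \<le> 0" by (rule field_le_epsilon) (use key in blast)
  then show "Im (\<phi> d) = 0" by simp
  show "cmod (\<phi> d) \<le> norm d" by (rule field_le_epsilon) (use key in blast)
qed

lemma Re_\<phi>_st: assumes "x \<in> D" shows "Re (\<phi> (st x)) = Re (\<phi> x)"
proof -
  have "Im (\<phi> (cs \<i> (x - st x))) = 0"
    using assms by (intro \<phi>_herm) (auto simp: D_closed st_cs st_diff cs_minus_left cs_diff)
  then show ?thesis using assms by (simp add: \<phi>_cs \<phi>_diff D_closed)
qed

section \<open>The real part of the state on the unitization of the subalgebra\<close>

definition unital_ext :: "'a unitization \<Rightarrow> real" where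
  "unital_ext x = Re (\<phi> (alg_part x)) + scal_part x"

definition D_unital :: "'a unitization set" where "D_unital = {x. alg_part x \<in> D}"

lemma D_unital_closed: "x \<in> D_unital \<Longrightarrow> y \<in> D_unital \<Longrightarrow> x + y \<in> D_unital" "x \<in> D_unital \<Longrightarrow> y \<in> D_unital \<Longrightarrow> x - y \<in> D_unital"
  "x \<in> D_unital \<Longrightarrow> c *\<^sub>R x \<in> D_unital" "x \<in> D_unital \<Longrightarrow> y \<in> D_unital \<Longrightarrow> x * y \<in> D_unital" "1 \<in> D_unital" "0 \<in> D_unital" "x \<in> D_unital \<Longrightarrow> ust x \<in> D_unital"
  "x \<in> D_unital \<Longrightarrow> - x \<in> D_unital"
  by (auto simp: D_unital_def D_closed ust_def)

lemma unital_ext_simps: "x \<in> D_unital \<Longrightarrow> y \<in> D_unital \<Longrightarrow> unital_ext (x + y) = unital_ext x + unital_ext y" "x \<in> D_unital \<Longrightarrow> y \<in> D_unital \<Longrightarrow> unital_ext (x - y) = unital_ext x - unital_ext y"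
  "x \<in> D_unital \<Longrightarrow> unital_ext (c *\<^sub>R x) = c * unital_ext x" "unital_ext 1 = 1" "x \<in> D_unital \<Longrightarrow> unital_ext (ust x) = unital_ext x" "unital_ext 0 = 0"
  "x \<in> D_unital \<Longrightarrow> unital_ext (- x) = - unital_ext x"
  by (auto simp: D_unital_def unital_ext_def \<phi>_add \<phi>_diff \<phi>_scaleR \<phi>_minus \<phi>_0 ust_def Re_\<phi>_st algebra_simps)

lemma unital_ext_norm: assumes "x \<in> D_unital" "ust x = x" shows "\<bar>unital_ext x\<bar> \<le> norm x"
proof -
  have "st (alg_part x) = alg_part x" using assms(2) by (cases x) (simp add: ust_def)
  then have "cmod (\<phi> (alg_part x)) \<le> norm (alg_part x)" using assms(1) by (intro \<phi>_herm) (auto simp: D_unital_def)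
  then show ?thesis using abs_Re_le_cmod[of "\<phi> (alg_part x)"] unfolding unital_ext_def norm_unitization_def by linarith
qed

lemma unital_ext_sq: assumes "x \<in> D_unital" "ust x = x" shows "(unital_ext x)\<^sup>2 \<le> unital_ext (x * x)"
proof -
  define d l where "d = alg_part x" and "l = scal_part x"
  have d: "d \<in> D" "st d = d" using assms by (cases x; simp add: ust_def D_unital_def d_def)+
  have "(cmod (\<phi> d))\<^sup>2 = (Re (\<phi> d))\<^sup>2" using \<phi>_herm(1)[OF d] by (simp add: cmod_power2)
  then have "(Re (\<phi> d))\<^sup>2 \<le> Re (\<phi> (d * d))" using cmod_\<phi>_sq_le[OF d(1)] d(2) by (simp add: sqn_def)
  moreover have "unital_ext (x * x) = Re (\<phi> (d * d)) + 2 * l * Re (\<phi> d) + l * l"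
    using d by (simp add: unital_ext_def d_def[symmetric] l_def[symmetric] \<phi>_add \<phi>_scaleR D_closed)
  ultimately show ?thesis by (simp add: unital_ext_def d_def[symmetric] l_def[symmetric] power2_eq_square algebra_simps)
qed

lemma unital_ext_power: "x \<in> D_unital \<Longrightarrow> ust x = x \<Longrightarrow> \<bar>unital_ext x\<bar> ^ (2 ^ n) \<le> norm (x ^ (2 ^ n))"
proof (induction n arbitrary: x)
  case 0 then show ?case using unital_ext_norm by simp
next
  case (Suc n)
  have "\<bar>unital_ext x\<bar> ^ (2 ^ Suc n) = ((unital_ext x)\<^sup>2) ^ (2 ^ n)" by (simp add: power_mult)
  also have "\<dots> \<le> \<bar>unital_ext (x * x)\<bar> ^ (2 ^ n)" using unital_ext_sq[OF Suc.prems] by (intro power_mono) auto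
  also have "\<dots> \<le> norm ((x * x) ^ (2 ^ n))" using Suc.prems by (intro Suc.IH) (auto simp: D_unital_closed U.st_mult)
  finally show ?case by (simp only: power_double)
qed

lemma unital_ext_small: assumes "x \<in> D_unital" "ust x = x" "small x" shows "unital_ext x < 1"
proof (rule ccontr)
  assume "\<not> unital_ext x < 1"
  then have f: "unital_ext x \<ge> 1" by simp
  obtain n where n: "norm (x ^ (2 ^ n)) < 1" using assms(3) unfolding small_def by blast
  have "1 \<le> \<bar>unital_ext x\<bar> ^ (2 ^ n)" using f by (intro one_le_power) simp
  then show False using unital_ext_power[OF assms(1,2), of n] n by simp
qed

text \<open>\<open>norm x - x\<close> has spectral radius at most \<open>norm x\<close>, so its
  value, \<open>norm x - unital_ext x\<close>, cannot exceed \<open>norm x\<close>.\<close>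

lemma unital_ext_pos: assumes "x \<in> D_unital" "U.pos x" shows "unital_ext x \<ge> 0"
proof -
  let ?t = "norm x"
  have sx: "ust x = x" using assms(2) by (simp add: U.pos_def)
  have "?t - unital_ext x \<le> t'" if t': "?t < t'" for t'
  proof -
    have t0: "t' > 0" using t' norm_ge_zero[of x] by linarith
    have "unital_ext ((1 / t') *\<^sub>R (?t *\<^sub>R 1 - x)) < 1"
      using assms t' sx by (intro unital_ext_small U.pos_small) (auto simp: D_unital_closed U.st_simps)
    then show ?thesis using t0 assms(1) by (simp add: unital_ext_simps D_unital_closed field_simps)
  qed
  then have "?t - unital_ext x \<le> ?t" by (rule dense_ge)
  then show ?thesis by simp
qed

section \<open>The extended state\<close>

definition herm_part :: "'a unitization \<Rightarrow> 'a unitization" where "herm_part x = (1/2) *\<^sub>R (x + ust x)"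

lemma herm_part: "ust (herm_part x) = herm_part x" "herm_part (x + y) = herm_part x + herm_part y" "herm_part (c *\<^sub>R x) = c *\<^sub>R herm_part x"
  "ust h = h \<Longrightarrow> herm_part h = h" "ust k = - k \<Longrightarrow> herm_part k = 0"
  by (simp_all add: herm_part_def U.st_simps scaleR_add_right add.commute scaleR_add_left[symmetric] algebra_simps)

text \<open>The M. Riesz majorant: the least value forced from above by the order. Passing to
  \<open>herm_part\<close> makes it at most 0 on skew elements and their negatives, so a dominated
  linear functional kills them.\<close>

definition dominating :: "'a unitization \<Rightarrow> real" where
  "dominating x = (INF w\<in>{w\<in>D_unital. U.pos (w - herm_part x)}. unital_ext w)"

lemma dominating_ne: "norm (herm_part x) *\<^sub>R 1 \<in> {w\<in>D_unital. U.pos (w - herm_part x)}"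
  by (simp add: D_unital_closed U.pos_norm herm_part)

lemma dominating_bdd: "bdd_below (unital_ext ` {w\<in>D_unital. U.pos (w - herm_part x)})"
proof (rule bdd_belowI2)
  fix w assume w: "w \<in> {w\<in>D_unital. U.pos (w - herm_part x)}"
  have "U.pos ((w - herm_part x) + (norm (herm_part x) *\<^sub>R 1 - (- herm_part x)))"
    using w by (intro U.pos_add U.pos_norm) (auto simp: U.st_simps herm_part)
  then have "U.pos (w + norm (herm_part x) *\<^sub>R 1)" by simp
  then have "unital_ext (w + norm (herm_part x) *\<^sub>R 1) \<ge> 0" using w by (intro unital_ext_pos) (auto simp: D_unital_closed)
  then show "- norm (herm_part x) \<le> unital_ext w" using w by (simp add: unital_ext_simps D_unital_closed)
qed

lemma dominating_le: "w \<in> D_unital \<Longrightarrow> U.pos (w - herm_part x) \<Longrightarrow> dominating x \<le> unital_ext w"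
  unfolding dominating_def by (rule cINF_lower[OF dominating_bdd]) simp

lemma dominating_ge: "(\<And>w. w \<in> D_unital \<Longrightarrow> U.pos (w - herm_part x) \<Longrightarrow> a \<le> unital_ext w) \<Longrightarrow> a \<le> dominating x"
  unfolding dominating_def by (rule cINF_greatest) (use dominating_ne in auto)

lemma sublinear_dominating: "sublinear dominating"
proof (rule sublinearI)
  fix x y
  have *: "dominating (x + y) \<le> unital_ext v + unital_ext w" if "v \<in> D_unital" "U.pos (v - herm_part x)" "w \<in> D_unital" "U.pos (w - herm_part y)" for v w
  proof -
    have "U.pos ((v + w) - herm_part (x + y))" using U.pos_add[OF that(2,4)] by (simp add: herm_part algebra_simps)
    then have "dominating (x + y) \<le> unital_ext (v + w)" using that by (intro dominating_le) (auto simp: D_unital_closed)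
    then show ?thesis using that by (simp add: unital_ext_simps)
  qed
  have "dominating (x + y) - unital_ext v \<le> dominating y" if "v \<in> D_unital" "U.pos (v - herm_part x)" for v
    by (rule dominating_ge) (use *[OF that] in force)
  then have "dominating (x + y) - dominating y \<le> dominating x" by (intro dominating_ge) force
  then show "dominating (x + y) \<le> dominating x + dominating y" by simp
next
  fix c :: real and x assume c: "c > 0"
  have "dominating (c *\<^sub>R x) / c \<le> dominating x"
  proof (rule dominating_ge)
    fix w assume w: "w \<in> D_unital" "U.pos (w - herm_part x)"
    have "U.pos (c *\<^sub>R w - herm_part (c *\<^sub>R x))" using U.pos_scaleR[OF w(2), of c] c by (simp add: herm_part scaleR_diff_right)
    then have "dominating (c *\<^sub>R x) \<le> unital_ext (c *\<^sub>R w)" using w by (intro dominating_le) (auto simp: D_unital_closed)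
    then show "dominating (c *\<^sub>R x) / c \<le> unital_ext w" using w c by (simp add: unital_ext_simps field_simps)
  qed
  then show "dominating (c *\<^sub>R x) \<le> c * dominating x" using c by (simp add: field_simps)
qed

lemma dominating_D_unital: assumes "w \<in> D_unital" shows "dominating w \<le> unital_ext w"
proof -
  have "herm_part w \<in> D_unital" "unital_ext (herm_part w) = unital_ext w" using assms by (simp_all add: herm_part_def D_unital_closed unital_ext_simps)
  then show ?thesis using dominating_le[of "herm_part w" w] by (simp add: U.pos_0)
qed

text \<open>Each property comes from one competitor in the infimum: \<open>herm_part w\<close> on
  \<open>D_unital\<close>, 0 for skew elements and for \<open>- (ust x * x)\<close>,
  \<open>norm h *\<^sub>R 1\<close> for hermitian \<open>h\<close>.\<close>

lemma extension_functional:
  obtains F where "linear F" "\<And>w. w \<in> D_unital \<Longrightarrow> F w = unital_ext w" "\<And>k. ust k = - k \<Longrightarrow> F k = 0"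
    "\<And>x. F (ust x * x) \<ge> 0" "\<And>h. ust h = h \<Longrightarrow> \<bar>F h\<bar> \<le> norm h"
proof -
  obtain F where F: "linear F" "\<And>x. F x \<le> dominating x" using sublinear_dominates_linear[OF sublinear_dominating] by blast
  note neg = linear_neg[OF F(1)]
  have 1: "F w = unital_ext w" if "w \<in> D_unital" for w
    using F(2)[of w] F(2)[of "- w"] dominating_D_unital[OF that] dominating_D_unital[of "- w"] that by (simp add: neg D_unital_closed unital_ext_simps)
  have sk: "F k \<le> 0" if "ust k = - k" for k
  proof -
    have "dominating k \<le> unital_ext 0" by (rule dominating_le) (simp_all add: herm_part that U.pos_0 D_unital_closed)
    then show ?thesis using F(2)[of k] by (simp add: unital_ext_simps)
  qed
  have 2: "F k = 0" if "ust k = - k" for k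
    using sk[OF that] sk[of "- k"] that by (simp add: neg U.st_minus)
  have 3: "F (ust x * x) \<ge> 0" for x
  proof -
    have "dominating (- (ust x * x)) \<le> unital_ext 0"
      by (rule dominating_le) (simp_all add: D_unital_closed herm_part(4) U.st_simps U.pos_star)
    then show ?thesis using F(2)[of "- (ust x * x)"] by (simp add: unital_ext_simps neg)
  qed
  have le: "F h \<le> norm h" if "ust h = h" for h
  proof -
    have "dominating h \<le> unital_ext (norm h *\<^sub>R 1)" by (rule dominating_le) (simp_all add: D_unital_closed herm_part(4) that U.pos_norm)
    then show ?thesis using F(2)[of h] by (simp add: unital_ext_simps D_unital_closed)
  qed
  have 4: "\<bar>F h\<bar> \<le> norm h" if "ust h = h" for h
    using le[OF that] le[of "- h"] that by (simp add: U.st_minus neg)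
  show thesis using that F(1) 1 2 3 4 by blast
qed

lemma state_extension: "\<exists>\<psi>. state_on cs st UNIV \<psi> \<and> (\<forall>x\<in>D. \<psi> x = \<phi> x)"
proof -
  obtain F where F: "linear F" "\<And>w. w \<in> D_unital \<Longrightarrow> F w = unital_ext w" "\<And>k. ust k = - k \<Longrightarrow> F k = 0"
    "\<And>x. F (ust x * x) \<ge> 0" "\<And>h. ust h = h \<Longrightarrow> \<bar>F h\<bar> \<le> norm h"
    using extension_functional by blast
  define G where "G a = F (Unitz a 0)" for a
  have G_add: "G (a + b) = G a + G b" for a b
    unfolding G_def linear_add[OF F(1), symmetric] by (intro arg_cong[of _ _ F] unitz_eqI) simp_all
  have G_scaleR: "G (r *\<^sub>R a) = r * G a" for r a
    using linear_scale[OF F(1), of r "Unitz a 0"] unfolding G_def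
    by (metis mult_zero_right real_scaleR_def scaleR_unitization_def unitization.sel)
  have G_skew: "G a = 0" if "st a = - a" for a
    unfolding G_def using that by (intro F(3) unitz_eqI) (simp_all add: ust_def)
  have G_st: "G (st a) = G a" for a
    using G_skew[of "a - st a"] G_add[of "a - st a" "st a"] by (simp add: st_diff)
  have G_D: "G a = Re (\<phi> a)" if "a \<in> D" for a
    unfolding G_def using F(2)[of "Unitz a 0"] that by (simp add: D_unital_def unital_ext_def)
  have G_sq: "G (st a * a) \<ge> 0" for a
    using F(4)[of "Unitz a 0"] by (simp add: G_def ust_def times_unitization_def)
  have G_norm: "\<bar>G a\<bar> \<le> norm a" if "st a = a" for a
    using F(5)[of "Unitz a 0"] that by (simp add: G_def ust_def)
  have G_var: "(G a)\<^sup>2 \<le> G (st a * a)" for a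
  proof -
    \<comment> \<open>The minimizer of \<open>G (st a * a) + 2 l G a + l\<^sup>2\<close>.\<close>
    define l where "l = - G a"
    have "0 \<le> F (ust (Unitz a l) * Unitz a l)" by (rule F(4))
    also have "ust (Unitz a l) * Unitz a l = Unitz (st a * a + l *\<^sub>R a + l *\<^sub>R st a) 0 + l\<^sup>2 *\<^sub>R 1"
      by (rule unitz_eqI) (simp_all add: ust_def power2_eq_square)
    also have "F \<dots> = G (st a * a) + l * G a + l * G a + l\<^sup>2"
      by (simp add: linear_add[OF F(1)] linear_scale[OF F(1)] F(2) D_unital_closed unital_ext_simps
          G_def[symmetric] G_add G_scaleR G_st)
    finally show ?thesis by (simp add: l_def power2_eq_square)
  qed
  \<comment> \<open>The unique complex linear functional with real part \<open>G\<close>.\<close>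
  define \<psi> where "\<psi> a = Complex (G a) (- G (cs \<i> a))" for a
  have ii: "cs \<i> (cs \<i> a) = - a" for a using cs_cs[of \<i> \<i> a] by (simp add: cs_minus_left)
  have G_minus: "G (- a) = - G a" for a using G_scaleR[of "- 1" a] by simp
  have G_cs: "G (cs c a) = Re c * G a + Im c * G (cs \<i> a)" for c a
    unfolding cs_Complex[of c a] by (simp add: G_add G_scaleR)
  have add: "\<psi> (a + b) = \<psi> a + \<psi> b" for a b
    by (simp add: \<psi>_def complex_eq_iff G_add cs_add)
  have scal: "\<psi> (cs c a) = c * \<psi> a" for c a
  proof -
    have "cs \<i> (cs c a) = cs c (cs \<i> a)" by (simp add: cs_cs mult.commute)
    then show ?thesis by (simp add: \<psi>_def complex_eq_iff G_cs[of c] ii G_minus)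
  qed
  have herm: "\<psi> h = complex_of_real (G h)" if "st h = h" for h
    using G_skew[of "cs \<i> h"] that by (simp add: \<psi>_def complex_eq_iff st_cs cs_minus_left)
  have sq: "\<psi> (st a * a) = complex_of_real (G (st a * a))" for a
    by (rule herm) (simp add: st_mult)
  have ext: "\<psi> x = \<phi> x" if "x \<in> D" for x
    using that by (simp add: \<psi>_def complex_eq_iff G_D D_closed \<phi>_cs)
  have diff: "\<psi> (a - b) = \<psi> a - \<psi> b" for a b
    using add[of "a - b" b] by simp
  have var: "(cmod (\<psi> a))\<^sup>2 \<le> Re (\<psi> (st a * a))" for a
  proof (cases "\<psi> a = 0")
    case True then show ?thesis using G_sq[of a] by (simp add: sq)
  next
    case False
    \<comment> \<open>A phase that makes \<open>\<psi> (cs c a)\<close> real and nonnegative while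
      leaving \<open>st a * a\<close> unchanged, so \<open>G_var\<close> applies.\<close>
    define c where "c = cnj (sgn (\<psi> a))"
    have "cmod c = 1" using False by (simp add: c_def norm_sgn)
    then have cc: "c * cnj c = 1" using complex_norm_square[of c] by simp
    have "\<psi> (cs c a) = complex_of_real (cmod (\<psi> a))"
      using False complex_norm_square[of "\<psi> a"]
      by (simp add: scal c_def sgn_eq mult.commute power2_eq_square nonzero_divide_eq_eq)
    then have "G (cs c a) = cmod (\<psi> a)" by (simp add: \<psi>_def complex_eq_iff)
    moreover have "st (cs c a) * cs c a = st a * a"
      using cc by (simp add: st_cs cs_mult_left cs_mult_right cs_cs mult.commute)
    ultimately show ?thesis using G_var[of "cs c a"] by (simp add: sq)
  qed
  have vb: "var_bound st UNIV \<psi> 1" using var by (simp add: var_bound_def)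
  \<comment> \<open>A bound for the extension restricts to one for \<open>\<phi>\<close>, so the
    variation cannot drop below 1.\<close>
  have "var_bound st D \<phi> \<gamma>" if "var_bound st UNIV \<psi> \<gamma>" for \<gamma>
    using that by (simp add: var_bound_def D_closed flip: ext)
  then have ge: "1 \<le> \<gamma>" if "var_bound st UNIV \<psi> \<gamma>" for \<gamma> using that var_bound_ge_1 by blast
  have variation: "variation st UNIV \<psi> = 1"
    unfolding variation_def by (rule cInf_eq_minimum) (use vb ge in auto)
  have "continuous_on {b \<in> UNIV. st b = b} (\<lambda>b. \<psi> (st c * b * c))" for c
  proof (rule lipschitz_on_continuous_on)
    \<comment> \<open>Only the norm of the fixed \<open>st c\<close> enters, so continuity of the
      involution is not involved.\<close>
    show "lipschitz_on (norm (st c) * norm c) {b \<in> UNIV. st b = b} (\<lambda>b. \<psi> (st c * b * c))"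
    proof (rule lipschitz_onI)
      fix x y assume xy: "x \<in> {b \<in> UNIV. st b = b}" "y \<in> {b \<in> UNIV. st b = b}"
      let ?h = "st c * (x - y) * c"
      have "st ?h = ?h" using xy by (simp add: st_mult st_diff mult.assoc)
      then have "cmod (\<psi> ?h) \<le> norm ?h" by (simp add: herm G_norm)
      also have "\<dots> \<le> norm (st c) * norm (x - y) * norm c"
        by (meson norm_mult_ineq norm_ge_zero mult_right_mono order_trans)
      finally show "dist (\<psi> (st c * x * c)) (\<psi> (st c * y * c)) \<le> norm (st c) * norm c * dist x y"
        by (simp add: dist_norm diff[symmetric] algebra_simps)
    qed simp
  qed
  then have "weakly_cont_sa st UNIV \<psi>" unfolding weakly_cont_sa_def by blast
  then have "state_on cs st UNIV \<psi>"
    unfolding state_on_def lin_fun_on_def positive_on_def finite_variation_def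
    using add scal sq G_sq vb variation by auto
  then show ?thesis using ext by blast
qed

end

theorem theorem29p2:
  fixes cs :: "complex \<Rightarrow> 'a::{real_normed_algebra,banach} \<Rightarrow> 'a"
    and st :: "'a \<Rightarrow> 'a"
    and D :: "'a set"
  assumes "banach_star_alg cs st"
    and "hermitian_alg cs st"
    and "star_subalg cs st D"
    and "closed D"
    and "state_on cs st D \<phi>"
  shows "\<exists>\<psi>. state_on cs st UNIV \<psi> \<and> (\<forall>x\<in>D. \<psi> x = \<phi> x)"
proof -
  interpret hermitian_star_state cs st D \<phi>
    by unfold_locales (use assms in auto)
  show ?thesis by (rule state_extension)
qed

end
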